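(* Let $R$ be a valuation ring and let $M$ be a polyserial $R$-module. Then the length of any pure-composition series of $M$ (with uniserial factors) equals $\mathrm{Mr}\,M$.
   Context: All rings are commutative with unity and all modules are unital. A module is uniserial if its submodules are linearly ordered by inclusion; a valuation ring is a ring which is uniserial as a module over itself (zero divisors are allowed). A submodule $F$ of $E$ is pure if the exact sequence $0\to F\to E\to E/F\to 0$ remains exact when tensored with any $R$-module. A module $M$ is polyserial if it has a pure-composition series $0=M_0\subset M_1\subset\dots\subset M_n=M$ (strict inclusions, each $M_k$ a pure submodule of $M$) where $M_k/M_{k-1}$ is uniserial for each $k$, $1\le k\le n$; the length of such a series is $n$. $\mathrm{gen}\,M$ denotes the minimal number of generators of a finitely generated module $M$. The Malcev rank of a module $N$ is $\mathrm{Mr}\,N=\sup\{\mathrm{gen}\,M\mid M\subseteq N,\ \mathrm{gen}\,M<\infty\}$. *)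

theory Defs
  imports "HOL-Library.Extended_Nat" "HOL-Algebra.Free_Abelian_Groups" "HOL-Algebra.AbelCoset"
    "HOL-Algebra.Module"
begin

section \<open>Quotient modules, uniserial modules, valuation rings\<close>

(* A submodule N of M is, as a module, M with its carrier replaced by N.  The module record of
   HOL-Algebra extends the ring record; its fields mult and one play no role for a module. *)
definition quotient_module ::
    "('r, 'a, 'm) module_scheme \<Rightarrow> 'a set \<Rightarrow> ('r, 'a set) module" where
  "quotient_module M N =
    \<lparr>carrier = a_rcosets\<^bsub>M\<^esub> N, monoid.mult = undefined, one = undefined,
     ring.zero = N, add = (<+>\<^bsub>M\<^esub>),
     smult = (\<lambda>r C. \<Union>x\<in>C. N +>\<^bsub>M\<^esub> (r \<odot>\<^bsub>M\<^esub> x))\<rparr>"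

definition uniserial :: "('r, 'p) ring_scheme \<Rightarrow> ('r, 'a, 'm) module_scheme \<Rightarrow> bool" where
  "uniserial R M \<longleftrightarrow> module R M \<and>
    (\<forall>A B. submodule A R M \<longrightarrow> submodule B R M \<longrightarrow> A \<subseteq> B \<or> B \<subseteq> A)"

definition regular_module :: "('r, 'p) ring_scheme \<Rightarrow> ('r, 'r) module" where
  "regular_module R =
    \<lparr>carrier = carrier R, monoid.mult = (\<otimes>\<^bsub>R\<^esub>), one = \<one>\<^bsub>R\<^esub>,
     ring.zero = \<zero>\<^bsub>R\<^esub>, add = (\<oplus>\<^bsub>R\<^esub>), smult = (\<otimes>\<^bsub>R\<^esub>)\<rparr>"

definition valuation_ring :: "('r, 'p) ring_scheme \<Rightarrow> bool" where
  "valuation_ring R \<longleftrightarrow> cring R \<and> uniserial R (regular_module R)"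


section \<open>Tensor products\<close>

(* Over a commutative ring, the abelian group underlying the tensor product is the free abelian
   group on the pairs modulo additivity in each argument and balancedness.  Exactness of a
   sequence of modules only concerns the underlying abelian groups, so the scalar multiplication
   of the tensor product is not needed. *)
definition tensor_rels ::
    "('r, 'p) ring_scheme \<Rightarrow> ('r, 'a, 'm) module_scheme \<Rightarrow> ('r, 'x, 'n) module_scheme
      \<Rightarrow> ('a \<times> 'x \<Rightarrow>\<^sub>0 int) set" where
  "tensor_rels R M X =
     {frag_of (a \<oplus>\<^bsub>M\<^esub> b, x) - frag_of (a, x) - frag_of (b, x) | a b x.
        a \<in> carrier M \<and> b \<in> carrier M \<and> x \<in> carrier X}
   \<union> {frag_of (a, x \<oplus>\<^bsub>X\<^esub> y) - frag_of (a, x) - frag_of (a, y) | a x y.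
        a \<in> carrier M \<and> x \<in> carrier X \<and> y \<in> carrier X}
   \<union> {frag_of (r \<odot>\<^bsub>M\<^esub> a, x) - frag_of (a, r \<odot>\<^bsub>X\<^esub> x) | r a x.
        r \<in> carrier R \<and> a \<in> carrier M \<and> x \<in> carrier X}"

definition tensor_kernel ::
    "('r, 'p) ring_scheme \<Rightarrow> ('r, 'a, 'm) module_scheme \<Rightarrow> ('r, 'x, 'n) module_scheme
      \<Rightarrow> ('a \<times> 'x \<Rightarrow>\<^sub>0 int) set" where
  "tensor_kernel R M X =
     generate (free_Abelian_group (carrier M \<times> carrier X)) (tensor_rels R M X)"

definition tensor ::
    "('r, 'p) ring_scheme \<Rightarrow> ('r, 'a, 'm) module_scheme \<Rightarrow> ('r, 'x, 'n) module_scheme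
      \<Rightarrow> ('a \<times> 'x \<Rightarrow>\<^sub>0 int) set monoid" where
  "tensor R M X = free_Abelian_group (carrier M \<times> carrier X) Mod tensor_kernel R M X"

definition frag_map :: "('a \<Rightarrow> 'b) \<Rightarrow> ('x \<Rightarrow> 'y) \<Rightarrow> ('a \<times> 'x \<Rightarrow>\<^sub>0 int) \<Rightarrow> ('b \<times> 'y \<Rightarrow>\<^sub>0 int)" where
  "frag_map f h = frag_extend (frag_of \<circ> (\<lambda>(a, x). (f a, h x)))"

(* The homomorphism from M \<otimes> X to M' \<otimes> X induced by a homomorphism f from M to M',
   i.e. a \<otimes> x is mapped to f a \<otimes> x. *)
definition tensor_map ::
    "('r, 'p) ring_scheme \<Rightarrow> ('a \<Rightarrow> 'b) \<Rightarrow> ('r, 'b, 'm) module_scheme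
      \<Rightarrow> ('r, 'x, 'n) module_scheme
      \<Rightarrow> ('a \<times> 'x \<Rightarrow>\<^sub>0 int) set \<Rightarrow> ('b \<times> 'x \<Rightarrow>\<^sub>0 int) set" where
  "tensor_map R f M' X C =
     (\<Union>c\<in>C. tensor_kernel R M' X
        #>\<^bsub>free_Abelian_group (carrier M' \<times> carrier X)\<^esub> frag_map f (\<lambda>x. x) c)"


section \<open>Purity\<close>

(* short_exact_sequence of HOL-Algebra requires the three groups to have the same element type. *)
definition short_exact ::
    "('a, 'm) monoid_scheme \<Rightarrow> ('b, 'n) monoid_scheme \<Rightarrow> ('c, 'k) monoid_scheme
      \<Rightarrow> ('a \<Rightarrow> 'b) \<Rightarrow> ('b \<Rightarrow> 'c) \<Rightarrow> bool" where
  "short_exact A B C f g \<longleftrightarrow>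
     group A \<and> group B \<and> group C \<and> f \<in> mon A B \<and> g \<in> epi B C \<and> f ` carrier A = kernel B C g"

definition exact_after_tensor ::
    "('r, 'p) ring_scheme \<Rightarrow> ('r, 'a, 'm) module_scheme \<Rightarrow> 'a set
      \<Rightarrow> ('r, 'x, 'n) module_scheme \<Rightarrow> bool" where
  "exact_after_tensor R M N X \<longleftrightarrow>
     short_exact (tensor R (M\<lparr>carrier := N\<rparr>) X) (tensor R M X) (tensor R (quotient_module M N) X)
       (tensor_map R (\<lambda>a. a) M X)
       (tensor_map R (\<lambda>a. N +>\<^bsub>M\<^esub> a) (quotient_module M N) X)"

(* A definition cannot quantify over all types, so X ranges over the modules whose elements are
   of type (nat \<Rightarrow> 'r) set.  Up to isomorphism these include all finitely generated modules
   (quotients of R^n), and the lemma pure_submoduleD below shows that exactness for them implies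
   exactness for every module X, of whatever type. *)
definition pure_submodule ::
    "('r, 'p) ring_scheme \<Rightarrow> ('r, 'a, 'm) module_scheme \<Rightarrow> 'a set \<Rightarrow> bool" where
  "pure_submodule R M N \<longleftrightarrow> submodule N R M \<and>
     (\<forall>X :: ('r, (nat \<Rightarrow> 'r) set) module. module R X \<longrightarrow> exact_after_tensor R M N X)"


subsection \<open>The test modules in the definition of purity suffice\<close>

lemma keys_diff_subset: "Poly_Mapping.keys a \<subseteq> S \<Longrightarrow> Poly_Mapping.keys b \<subseteq> S \<Longrightarrow> Poly_Mapping.keys (a - b) \<subseteq> S"
  using keys_diff[of a b] by blast

lemma keys_add_subset: "Poly_Mapping.keys a \<subseteq> S \<Longrightarrow> Poly_Mapping.keys b \<subseteq> S \<Longrightarrow> Poly_Mapping.keys (a + b) \<subseteq> S"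
  using Poly_Mapping.keys_add[of a b] by blast

lemma tensor_relsI:
  "a \<in> carrier M \<Longrightarrow> b \<in> carrier M \<Longrightarrow> x \<in> carrier X \<Longrightarrow>
     frag_of (a \<oplus>\<^bsub>M\<^esub> b, x) - frag_of (a, x) - frag_of (b, x) \<in> tensor_rels R M X"
  "a \<in> carrier M \<Longrightarrow> x \<in> carrier X \<Longrightarrow> y \<in> carrier X \<Longrightarrow>
     frag_of (a, x \<oplus>\<^bsub>X\<^esub> y) - frag_of (a, x) - frag_of (a, y) \<in> tensor_rels R M X"
  "r \<in> carrier R \<Longrightarrow> a \<in> carrier M \<Longrightarrow> x \<in> carrier X \<Longrightarrow>
     frag_of (r \<odot>\<^bsub>M\<^esub> a, x) - frag_of (a, r \<odot>\<^bsub>X\<^esub> x) \<in> tensor_rels R M X"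
  unfolding tensor_rels_def by blast+

lemma tensor_relsE:
  assumes "c \<in> tensor_rels R M X"
  obtains a b x where "a \<in> carrier M" "b \<in> carrier M" "x \<in> carrier X"
      "c = frag_of (a \<oplus>\<^bsub>M\<^esub> b, x) - frag_of (a, x) - frag_of (b, x)"
  | a x y where "a \<in> carrier M" "x \<in> carrier X" "y \<in> carrier X"
      "c = frag_of (a, x \<oplus>\<^bsub>X\<^esub> y) - frag_of (a, x) - frag_of (a, y)"
  | r a x where "r \<in> carrier R" "a \<in> carrier M" "x \<in> carrier X"
      "c = frag_of (r \<odot>\<^bsub>M\<^esub> a, x) - frag_of (a, r \<odot>\<^bsub>X\<^esub> x)"
  using assms unfolding tensor_rels_def by blast

lemma tensor_rels_carrier:
  assumes "module R M" "module R X" "c \<in> tensor_rels R M X"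
  shows "Poly_Mapping.keys c \<subseteq> carrier M \<times> carrier X"
proof -
  interpret M: module R M by fact
  interpret X: module R X by fact
  show ?thesis using assms(3)
    by (cases rule: tensor_relsE) (simp_all add: keys_diff_subset)
qed

lemma tensor_kernel_carrier:
  assumes "module R M" "module R X" "c \<in> tensor_kernel R M X"
  shows "Poly_Mapping.keys c \<subseteq> carrier M \<times> carrier X"
proof -
  have "tensor_rels R M X \<subseteq> carrier (free_Abelian_group (carrier M \<times> carrier X))"
    using tensor_rels_carrier[OF assms(1,2)] by (intro subsetI) simp
  from group.generate_in_carrier[OF group_free_Abelian_group this] assms(3) show ?thesis
    by (simp add: tensor_kernel_def)
qed

lemma tensor_kernel_normal:
  assumes "module R M" "module R X"
  shows "tensor_kernel R M X \<lhd> free_Abelian_group (carrier M \<times> carrier X)"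
  unfolding tensor_kernel_def
  by (rule comm_group.normal_iff_subgroup[OF abelian_free_Abelian_group, THEN iffD2],
      rule group.generate_is_subgroup[OF group_free_Abelian_group])
    (use tensor_rels_carrier[OF assms] in auto)

lemma tensor_kernel_zero: "0 \<in> tensor_kernel R M X"
  unfolding tensor_kernel_def by (metis generate.one one_free_Abelian_group)

lemma tensor_kernel_rel: "c \<in> tensor_rels R M X \<Longrightarrow> c \<in> tensor_kernel R M X"
  unfolding tensor_kernel_def by (rule generate.incl)

lemma tensor_kernel_add:
  "a \<in> tensor_kernel R M X \<Longrightarrow> b \<in> tensor_kernel R M X \<Longrightarrow> a + b \<in> tensor_kernel R M X"
  unfolding tensor_kernel_def using generate.eng by fastforce

lemma tensor_kernel_minus:
  assumes "module R M" "module R X" "a \<in> tensor_kernel R M X"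
  shows "- a \<in> tensor_kernel R M X"
  using subgroup.m_inv_closed[OF normal_imp_subgroup[OF tensor_kernel_normal[OF assms(1,2)]] assms(3)]
    tensor_kernel_carrier[OF assms] by simp

lemma tensor_kernel_induct [consumes 3, case_names zero rel minus add]:
  assumes M: "module R M" "module R X" and "c \<in> tensor_kernel R M X"
    and "P 0" and rel: "\<And>c. c \<in> tensor_rels R M X \<Longrightarrow> P c"
    and minus: "\<And>c. P c \<Longrightarrow> P (- c)"
    and add: "\<And>a b. P a \<Longrightarrow> P b \<Longrightarrow> P (a + b)"
  shows "P c"
  using assms(3) unfolding tensor_kernel_def
proof (induction rule: generate.induct)
  case (inv h) then show ?case
    using tensor_rels_carrier[OF M inv] rel minus by auto
qed (use assms in auto)

lemma frag_map_simps [simp]: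
  "frag_map f h 0 = 0" "frag_map f h (frag_of (a, x)) = frag_of (f a, h x)"
  "frag_map f h (- c) = - frag_map f h c" 
  "frag_map f h (c + d) = frag_map f h c + frag_map f h d" 
  "frag_map f h (c - d) = frag_map f h c - frag_map f h d"
  by (simp_all add: frag_map_def frag_extend_minus frag_extend_add frag_extend_diff)

lemma frag_map_compose: "frag_map f h (frag_map f' h' c) = frag_map (f \<circ> f') (h \<circ> h') c"
  unfolding frag_map_def frag_extend_compose
  by (intro arg_cong[where f="\<lambda>g. frag_extend g c"]) auto

lemma frag_map_cong:
  assumes "\<And>a x. (a, x) \<in> Poly_Mapping.keys c \<Longrightarrow> f a = f' a \<and> h x = h' x"
  shows "frag_map f h c = frag_map f' h' c"
  unfolding frag_map_def by (rule frag_extend_eq) (use assms in auto)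

lemma frag_map_id: "frag_map (\<lambda>a. a) (\<lambda>x. x) c = c"
proof -
  have "(\<lambda>(a, x). (a, x)) = (\<lambda>p. p :: 'a \<times> 'b)" by auto
  then show ?thesis unfolding frag_map_def using frag_expansion[of c] by (simp add: comp_def)
qed

lemma keys_frag_map:
  "Poly_Mapping.keys (frag_map f h c) \<subseteq> (\<lambda>(a, x). (f a, h x)) ` Poly_Mapping.keys c"
  unfolding frag_map_def using keys_frag_extend by fastforce

definition mod_hom where
  "mod_hom R M M' f \<longleftrightarrow> f \<in> carrier M \<rightarrow> carrier M' \<and>
     (\<forall>a\<in>carrier M. \<forall>b\<in>carrier M. f (a \<oplus>\<^bsub>M\<^esub> b) = f a \<oplus>\<^bsub>M'\<^esub> f b) \<and>
     (\<forall>r\<in>carrier R. \<forall>a\<in>carrier M. f (r \<odot>\<^bsub>M\<^esub> a) = r \<odot>\<^bsub>M'\<^esub> f a)"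

lemma frag_map_tensor_kernel:
  assumes M: "module R M" "module R X" "module R M'" "module R X'"
    and f: "mod_hom R M M' f" and h: "mod_hom R X X' h" and c: "c \<in> tensor_kernel R M X"
  shows "frag_map f h c \<in> tensor_kernel R M' X'"
  using M(1,2) c
proof (induction rule: tensor_kernel_induct)
  case (rel c)
  have cl: "a \<in> carrier M \<Longrightarrow> f a \<in> carrier M'" "x \<in> carrier X \<Longrightarrow> h x \<in> carrier X'" for a x
    using f h unfolding mod_hom_def by auto
  show ?case using rel
  proof (cases rule: tensor_relsE)
    case (1 a b x)
    then have eq: "frag_map f h c = frag_of (f a \<oplus>\<^bsub>M'\<^esub> f b, h x) - frag_of (f a, h x) - frag_of (f b, h x)"
      using f by (simp add: mod_hom_def)
    show ?thesis unfolding eq by (rule tensor_kernel_rel[OF tensor_relsI(1)]) (use cl 1 in auto)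
  next
    case (2 a x y)
    then have eq: "frag_map f h c = frag_of (f a, h x \<oplus>\<^bsub>X'\<^esub> h y) - frag_of (f a, h x) - frag_of (f a, h y)"
      using h by (simp add: mod_hom_def)
    show ?thesis unfolding eq by (rule tensor_kernel_rel[OF tensor_relsI(2)]) (use cl 2 in auto)
  next
    case (3 r a x)
    then have eq: "frag_map f h c = frag_of (r \<odot>\<^bsub>M'\<^esub> f a, h x) - frag_of (f a, r \<odot>\<^bsub>X'\<^esub> h x)"
      using f h by (simp add: mod_hom_def)
    show ?thesis unfolding eq by (rule tensor_kernel_rel[OF tensor_relsI(3)]) (use cl 3 in auto)
  qed
qed (auto simp: tensor_kernel_zero tensor_kernel_add tensor_kernel_minus[OF M(3,4)])

(* A relation in M \<otimes> X already holds in M \<otimes> Y for some finitely generated Y \<subseteq> X. *)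
lemma tensor_kernel_finite:
  assumes M: "module R M" "module R X" and c: "c \<in> tensor_kernel R M X"
  shows "\<exists>S. finite S \<and> S \<subseteq> carrier X \<and>
    (\<forall>Y. submodule Y R X \<longrightarrow> S \<subseteq> Y \<longrightarrow> c \<in> tensor_kernel R M (X\<lparr>carrier := Y\<rparr>))"
  using M c
proof (induction rule: tensor_kernel_induct)
  case zero show ?case by (intro exI[of _ "{}"]) (auto simp: tensor_kernel_zero)
next
  case (rel c)
  interpret X: module R X by fact
  have "\<exists>S. finite S \<and> S \<subseteq> carrier X \<and>
    (\<forall>Y. submodule Y R X \<longrightarrow> S \<subseteq> Y \<longrightarrow> c \<in> tensor_rels R M (X\<lparr>carrier := Y\<rparr>))"
    using rel
  proof (cases rule: tensor_relsE)
    case (1 a b x)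
    then show ?thesis using tensor_relsI(1)[of a M b x "X\<lparr>carrier := _\<rparr>" R]
      by (intro exI[of _ "{x}"]) simp
  next
    case (2 a x y)
    then show ?thesis using tensor_relsI(2)[of a M x "X\<lparr>carrier := _\<rparr>" y R]
      by (intro exI[of _ "{x, y}"]) simp
  next
    case (3 r a x)
    then show ?thesis using tensor_relsI(3)[of r R a M x "X\<lparr>carrier := _\<rparr>"]
      by (intro exI[of _ "{x}"]) simp
  qed
  then obtain S where "finite S" "S \<subseteq> carrier X"
    "\<And>Y. submodule Y R X \<Longrightarrow> S \<subseteq> Y \<Longrightarrow> c \<in> tensor_rels R M (X\<lparr>carrier := Y\<rparr>)"
    by metis
  then show ?case by (intro exI[of _ S] conjI allI impI tensor_kernel_rel)
next
  case (minus c)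
  then obtain S where "finite S" "S \<subseteq> carrier X"
    "\<And>Y. submodule Y R X \<Longrightarrow> S \<subseteq> Y \<Longrightarrow> c \<in> tensor_kernel R M (X\<lparr>carrier := Y\<rparr>)"
    by metis
  then show ?case
    by (intro exI[of _ S] conjI allI impI tensor_kernel_minus[OF M(1)]
        submodule.submodule_is_module[OF _ M(2)])
next
  case (add a b)
  then obtain S T where
    S: "finite S" "S \<subseteq> carrier X" "\<And>Y. submodule Y R X \<Longrightarrow> S \<subseteq> Y \<Longrightarrow> a \<in> tensor_kernel R M (X\<lparr>carrier := Y\<rparr>)" and
    T: "finite T" "T \<subseteq> carrier X" "\<And>Y. submodule Y R X \<Longrightarrow> T \<subseteq> Y \<Longrightarrow> b \<in> tensor_kernel R M (X\<lparr>carrier := Y\<rparr>)"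
    by metis
  show ?case by (intro exI[of _ "S \<union> T"]) (use S T in \<open>auto intro!: tensor_kernel_add\<close>)
qed

fun lincomb where
  "lincomb X a [] = \<zero>\<^bsub>X\<^esub>"
| "lincomb X a (x # xs) = (a 0 \<odot>\<^bsub>X\<^esub> x) \<oplus>\<^bsub>X\<^esub> lincomb X (\<lambda>i. a (Suc i)) xs"

context module begin

lemma lincomb_closed: "range a \<subseteq> carrier R \<Longrightarrow> set xs \<subseteq> carrier M \<Longrightarrow> lincomb M a xs \<in> carrier M"
  by (induction xs arbitrary: a) (auto simp: image_subset_iff)

lemma lincomb_add: "range a \<subseteq> carrier R \<Longrightarrow> range b \<subseteq> carrier R \<Longrightarrow> set xs \<subseteq> carrier M \<Longrightarrow>
   lincomb M (\<lambda>i. a i \<oplus>\<^bsub>R\<^esub> b i) xs = lincomb M a xs \<oplus>\<^bsub>M\<^esub> lincomb M b xs"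
proof (induction xs arbitrary: a b)
  case (Cons x xs)
  have r: "range (\<lambda>i. a (Suc i)) \<subseteq> carrier R" "range (\<lambda>i. b (Suc i)) \<subseteq> carrier R" "a 0 \<in> carrier R" "b 0 \<in> carrier R"
    using Cons.prems by auto
  have "lincomb M (\<lambda>i. a (Suc i)) xs \<in> carrier M" "lincomb M (\<lambda>i. b (Suc i)) xs \<in> carrier M"
    using lincomb_closed r Cons.prems by auto
  then show ?case
    using Cons.prems r Cons.IH[OF r(1,2)]
    by (simp add: smult_l_distr M.a_ac)
qed simp

lemma lincomb_smult: "range a \<subseteq> carrier R \<Longrightarrow> r \<in> carrier R \<Longrightarrow> set xs \<subseteq> carrier M \<Longrightarrow>
   lincomb M (\<lambda>i. r \<otimes>\<^bsub>R\<^esub> a i) xs = r \<odot>\<^bsub>M\<^esub> lincomb M a xs"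
proof (induction xs arbitrary: a)
  case (Cons x xs)
  have r: "range (\<lambda>i. a (Suc i)) \<subseteq> carrier R" "a 0 \<in> carrier R" 
    using Cons.prems by auto
  have "lincomb M (\<lambda>i. a (Suc i)) xs \<in> carrier M"
    using lincomb_closed r Cons.prems by auto
  then show ?case
    using Cons.prems r Cons.IH[OF r(1)]
    by (simp add: smult_r_distr smult_assoc1)
qed simp

lemma lincomb_zero: "set xs \<subseteq> carrier M \<Longrightarrow> lincomb M (\<lambda>i. \<zero>\<^bsub>R\<^esub>) xs = \<zero>\<^bsub>M\<^esub>"
  by (induction xs) (auto simp: comp_def)

lemma lincomb_mem: "set xs \<subseteq> carrier M \<Longrightarrow> x \<in> set xs \<Longrightarrow> \<exists>a. range a \<subseteq> carrier R \<and> lincomb M a xs = x"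
proof (induction xs)
  case (Cons y xs)
  show ?case
  proof (cases "x = y")
    case True
    show ?thesis
      by (rule exI[of _ "case_nat \<one>\<^bsub>R\<^esub> (\<lambda>i. \<zero>\<^bsub>R\<^esub>)"])
        (use Cons.prems lincomb_zero True in \<open>auto simp: comp_def split: nat.splits\<close>)
  next
    case False
    then obtain a where "range a \<subseteq> carrier R" "lincomb M a xs = x" using Cons by auto
    then show ?thesis
      by (intro exI[of _ "case_nat \<zero>\<^bsub>R\<^esub> a"])
        (use Cons.prems False in \<open>auto simp: image_subset_iff split: nat.splits\<close>)
  qed
qed simp

(* x is encoded by the set of all coefficient sequences representing it. *)
lemma small_submodule:
  assumes "finite S" "S \<subseteq> carrier M"
  obtains Y and \<sigma> :: "'c \<Rightarrow> (nat \<Rightarrow> 'a) set" where "submodule Y R M" "S \<subseteq> Y" "inj_on \<sigma> Y"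
proof -
  obtain xs where xs: "set xs = S" using assms finite_list by blast
  let ?A = "{a. range a \<subseteq> carrier R}"
  let ?Y = "(\<lambda>a. lincomb M a xs) ` ?A"
  have sub: "set xs \<subseteq> carrier M" using xs assms by simp
  have sm: "r \<odot>\<^bsub>M\<^esub> x \<in> ?Y" if "r \<in> carrier R" "x \<in> ?Y" for r x
  proof -
    obtain a where a: "range a \<subseteq> carrier R" "x = lincomb M a xs" using \<open>x \<in> ?Y\<close> by auto
    then have "r \<odot>\<^bsub>M\<^esub> x = lincomb M (\<lambda>i. r \<otimes>\<^bsub>R\<^esub> a i) xs" using lincomb_smult sub that by simp
    moreover have "range (\<lambda>i. r \<otimes>\<^bsub>R\<^esub> a i) \<subseteq> carrier R" using a that by auto
    ultimately show ?thesis by blast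
  qed
  have "submodule ?Y R M"
  proof (rule submoduleI)
    show Yc: "?Y \<subseteq> carrier M" using lincomb_closed sub by auto
    show "\<zero>\<^bsub>M\<^esub> \<in> ?Y" using lincomb_zero[OF sub] by (intro image_eqI[of _ _ "\<lambda>i. \<zero>\<^bsub>R\<^esub>"]) auto
    show "\<ominus>\<^bsub>M\<^esub> x \<in> ?Y" if "x \<in> ?Y" for x
    proof -
      have "(\<ominus>\<^bsub>R\<^esub> \<one>\<^bsub>R\<^esub>) \<odot>\<^bsub>M\<^esub> x = \<ominus>\<^bsub>M\<^esub> x" using that Yc smult_l_minus[of "\<one>\<^bsub>R\<^esub>" x] by auto
      then show ?thesis using sm[of "\<ominus>\<^bsub>R\<^esub> \<one>\<^bsub>R\<^esub>", OF _ that] by simp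
    qed
    show "x \<oplus>\<^bsub>M\<^esub> y \<in> ?Y" if xy: "x \<in> ?Y" "y \<in> ?Y" for x y
    proof -
      obtain a where a: "range a \<subseteq> carrier R" "x = lincomb M a xs" using xy by auto
      obtain b where b: "range b \<subseteq> carrier R" "y = lincomb M b xs" using xy by auto
      have "x \<oplus>\<^bsub>M\<^esub> y = lincomb M (\<lambda>i. a i \<oplus>\<^bsub>R\<^esub> b i) xs" using lincomb_add sub a b by simp
      moreover have "range (\<lambda>i. a i \<oplus>\<^bsub>R\<^esub> b i) \<subseteq> carrier R" using a b by auto
      ultimately show ?thesis by blast
    qed
  qed (use sm in auto)
  moreover have "S \<subseteq> ?Y" using lincomb_mem[OF sub] xs by blast
  moreover have "inj_on (\<lambda>x. {a \<in> ?A. lincomb M a xs = x}) ?Y"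
    by (rule inj_onI) blast
  ultimately show thesis by (rule that)
qed

lemma transport_module:
  assumes "submodule Y R M" "inj_on \<sigma> Y"
  obtains U :: "('a, 'u) module" where "module R U" "mod_hom R (M\<lparr>carrier := Y\<rparr>) U (\<sigma> :: 'c \<Rightarrow> 'u)"
    "mod_hom R U M (the_inv_into Y \<sigma>)" "carrier U = \<sigma> ` Y"
proof -
  let ?t = "the_inv_into Y \<sigma>"
  define U :: "('a, 'u) module" where "U = \<lparr>carrier = \<sigma> ` Y, monoid.mult = undefined, one = undefined,
     ring.zero = \<sigma> \<zero>\<^bsub>M\<^esub>, add = (\<lambda>u v. \<sigma> (?t u \<oplus>\<^bsub>M\<^esub> ?t v)), smult = (\<lambda>r u. \<sigma> (r \<odot>\<^bsub>M\<^esub> ?t u))\<rparr>"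
  note Y = submoduleE[OF assms(1)]
  have tY: "y \<in> Y \<Longrightarrow> ?t (\<sigma> y) = y" for y using the_inv_into_f_f[OF assms(2)] .
  have z: "\<zero>\<^bsub>M\<^esub> \<in> Y" using assms(1) by (metis M.add.l_inv_ex M.r_neg Y(1,2,3,5) all_not_in_conv subsetD)
  have Yc: "y \<in> Y \<Longrightarrow> y \<in> carrier M" for y using Y(1) by auto
  have "module R U"
  proof (rule moduleI)
    show "abelian_group U"
    proof (rule abelian_groupI)
      fix u assume "u \<in> carrier U"
      then obtain y where "u = \<sigma> y" "y \<in> Y" by (auto simp: U_def)
      then show "\<exists>v\<in>carrier U. v \<oplus>\<^bsub>U\<^esub> u = \<zero>\<^bsub>U\<^esub>"
        using Y(3)[of y] tY Yc by (intro bexI[of _ "\<sigma> (\<ominus>\<^bsub>M\<^esub> y)"]) (auto simp: U_def M.l_neg)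
    qed (use z Y tY Yc in \<open>auto simp: U_def M.a_ac\<close>)
  qed (use Y tY Yc in \<open>auto simp: U_def smult_l_distr smult_r_distr smult_assoc1 R.is_cring intro: is_cring\<close>)
  moreover have "mod_hom R (M\<lparr>carrier := Y\<rparr>) U \<sigma>" using tY by (auto simp: mod_hom_def U_def)
  moreover have "mod_hom R U M ?t" using tY Y Yc by (auto simp: mod_hom_def U_def)
  moreover have "carrier U = \<sigma> ` Y" by (simp add: U_def)
  ultimately show thesis by (rule that)
qed

end

lemma quotient_module_is_module:
  assumes "module R M" "submodule N R M"
  shows "module R (quotient_module M N)" "mod_hom R M (quotient_module M N) (\<lambda>a. N +>\<^bsub>M\<^esub> a)"
    "carrier (quotient_module M N) = (\<lambda>a. N +>\<^bsub>M\<^esub> a) ` carrier M"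
proof -
  interpret module R M by fact
  interpret N: abelian_subgroup N M
    using abelian_subgroupI3[of N M] submodule.axioms(1)[OF assms(2)] M.abelian_group_axioms
    unfolding additive_subgroup_def by simp
  let ?Q = "quotient_module M N" and ?p = "\<lambda>a. N +>\<^bsub>M\<^esub> a"
  show c: "carrier ?Q = ?p ` carrier M"
    by (auto simp: quotient_module_def A_RCOSETS_def')
  have add: "?p a \<oplus>\<^bsub>?Q\<^esub> ?p b = ?p (a \<oplus>\<^bsub>M\<^esub> b)" if "a \<in> carrier M" "b \<in> carrier M" for a b
    using N.a_rcos_sum that by (simp add: quotient_module_def)
  have sm: "r \<odot>\<^bsub>?Q\<^esub> ?p a = ?p (r \<odot>\<^bsub>M\<^esub> a)" if r: "r \<in> carrier R" and a: "a \<in> carrier M" for r a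
  proof -
    have "?p (r \<odot>\<^bsub>M\<^esub> x) = ?p (r \<odot>\<^bsub>M\<^esub> a)" if x: "x \<in> ?p a" for x
    proof -
      obtain n where n: "n \<in> N" "x = n \<oplus>\<^bsub>M\<^esub> a" using x by (auto simp: a_r_coset_def')
      have nc: "n \<in> carrier M" using n N.a_Hcarr by blast
      have "r \<odot>\<^bsub>M\<^esub> x = r \<odot>\<^bsub>M\<^esub> n \<oplus>\<^bsub>M\<^esub> r \<odot>\<^bsub>M\<^esub> a" using n nc r a smult_r_distr by simp
      moreover have rn: "r \<odot>\<^bsub>M\<^esub> n \<in> N" using submodule.smult_closed[OF assms(2) r n(1)] .
      ultimately have "r \<odot>\<^bsub>M\<^esub> x \<in> ?p (r \<odot>\<^bsub>M\<^esub> a)" by (auto simp: a_r_coset_def')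
      from M.a_repr_independence[OF this smult_closed[OF r a] N.a_subgroup] show ?thesis ..
    qed
    then have "(\<Union>x\<in>?p a. ?p (r \<odot>\<^bsub>M\<^esub> x)) = (\<Union>x\<in>?p a. ?p (r \<odot>\<^bsub>M\<^esub> a))"
      by (intro SUP_cong refl)
    moreover have "?p a \<noteq> {}" using N.a_rcos_self[OF a] by blast
    ultimately show ?thesis by (simp add: quotient_module_def)
  qed
  show "mod_hom R M ?Q ?p" using c add sm unfolding mod_hom_def by auto
  have z: "\<zero>\<^bsub>?Q\<^esub> = ?p \<zero>\<^bsub>M\<^esub>" by (simp add: quotient_module_def N.a_subset)
  show "module R ?Q"
  proof (rule moduleI)
    show "abelian_group ?Q"
    proof (rule abelian_groupI)
      fix u assume "u \<in> carrier ?Q"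
      then obtain a where a: "a \<in> carrier M" "u = ?p a" using c by auto
      then show "\<exists>v\<in>carrier ?Q. v \<oplus>\<^bsub>?Q\<^esub> u = \<zero>\<^bsub>?Q\<^esub>"
        using add[of "\<ominus>\<^bsub>M\<^esub> a" a] z c by (intro bexI[of _ "?p (\<ominus>\<^bsub>M\<^esub> a)"]) (auto simp: M.l_neg)
    qed (use c add z in \<open>auto simp: M.a_ac\<close>)
  qed (use c add sm in \<open>auto simp: smult_l_distr smult_r_distr smult_assoc1 R.is_cring intro: is_cring\<close>)
qed

lemma tensor_group:
  assumes "module R M" "module R X"
  shows "group (tensor R M X)"
  unfolding tensor_def by (rule normal.factorgroup_is_group[OF tensor_kernel_normal[OF assms]])

abbreviation tensor_class where
  "tensor_class R M X c \<equiv>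
    tensor_kernel R M X #>\<^bsub>free_Abelian_group (carrier M \<times> carrier X)\<^esub> c"

lemma tensor_class_eq_iff:
  assumes "module R M" "module R X"
    "Poly_Mapping.keys c \<subseteq> carrier M \<times> carrier X" "Poly_Mapping.keys d \<subseteq> carrier M \<times> carrier X"
  shows "tensor_class R M X c = tensor_class R M X d \<longleftrightarrow> c - d \<in> tensor_kernel R M X"
proof
  let ?F = "free_Abelian_group (carrier M \<times> carrier X)"
  have K: "subgroup (tensor_kernel R M X) ?F"
    using normal_imp_subgroup tensor_kernel_normal[OF assms(1,2)] .
  {
    assume "tensor_class R M X c = tensor_class R M X d"
    then have "c \<in> tensor_class R M X d"
      using group.rcos_self[OF group_free_Abelian_group _ K, of c] assms by auto
    then show "c - d \<in> tensor_kernel R M X" by (auto simp: r_coset_def)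
  next
    assume "c - d \<in> tensor_kernel R M X"
    then have "(c - d) + d \<in> tensor_class R M X d"
      unfolding r_coset_def mult_free_Abelian_group by blast
    then have "c \<in> tensor_class R M X d" by simp
    then show "tensor_class R M X c = tensor_class R M X d"
      using group.repr_independence[OF group_free_Abelian_group _ _ K, of c d] assms by simp
  }
qed

lemma carrier_tensor:
  "carrier (tensor R M X) = tensor_class R M X ` {c. Poly_Mapping.keys c \<subseteq> carrier M \<times> carrier X}"
proof -
  have "carrier (free_Abelian_group (carrier M \<times> carrier X))
      = {c. Poly_Mapping.keys c \<subseteq> carrier M \<times> carrier X}" by auto
  then show ?thesis unfolding tensor_def carrier_FactGroup by simp
qed

lemma tensor_class_add:
  assumes "module R M" "module R X"
    "Poly_Mapping.keys c \<subseteq> carrier M \<times> carrier X" "Poly_Mapping.keys d \<subseteq> carrier M \<times> carrier X"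
  shows "tensor_class R M X c \<otimes>\<^bsub>tensor R M X\<^esub> tensor_class R M X d = tensor_class R M X (c + d)"
  unfolding tensor_def
  using normal.rcos_sum[OF tensor_kernel_normal[OF assms(1,2)], of c d] assms(3,4) by simp

lemma tensor_one:
  assumes "module R M" "module R X"
  shows "\<one>\<^bsub>tensor R M X\<^esub> = tensor_class R M X 0"
  using group.coset_mult_one[OF group_free_Abelian_group, of "tensor_kernel R M X" "carrier M \<times> carrier X"]
    tensor_kernel_carrier[OF assms] unfolding tensor_def by (auto simp: subset_iff)

lemma keys_frag_map_subset:
  assumes "Poly_Mapping.keys c \<subseteq> A \<times> X" "\<And>a. a \<in> A \<Longrightarrow> f a \<in> B" "\<And>x. x \<in> X \<Longrightarrow> h x \<in> Y"
  shows "Poly_Mapping.keys (frag_map f h c) \<subseteq> B \<times> Y"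
  using keys_frag_map[of f h c] assms by fastforce

lemma mod_hom_id: "mod_hom R X X (\<lambda>x. x)"
  by (auto simp: mod_hom_def)

lemma tensor_map_class:
  assumes M: "module R M" "module R X" "module R M'" and f: "mod_hom R M M' f"
    and c: "Poly_Mapping.keys c \<subseteq> carrier M \<times> carrier X"
  shows "tensor_map R f M' X (tensor_class R M X c) = tensor_class R M' X (frag_map f (\<lambda>x. x) c)"
proof -
  have fc: "a \<in> carrier M \<Longrightarrow> f a \<in> carrier M'" for a using f by (auto simp: mod_hom_def)
  have K: "subgroup (tensor_kernel R M X) (free_Abelian_group (carrier M \<times> carrier X))"
    using normal_imp_subgroup tensor_kernel_normal[OF M(1,2)] .
  have "tensor_class R M' X (frag_map f (\<lambda>x. x) d) = tensor_class R M' X (frag_map f (\<lambda>x. x) c)"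
    if d: "d \<in> tensor_class R M X c" for d
  proof -
    obtain k where k: "k \<in> tensor_kernel R M X" "d = k + c" using d by (auto simp: r_coset_def)
    have d': "Poly_Mapping.keys d \<subseteq> carrier M \<times> carrier X"
      using k tensor_kernel_carrier[OF M(1,2)] c by (simp add: keys_add_subset)
    have "Poly_Mapping.keys (frag_map f (\<lambda>x. x) d) \<subseteq> carrier M' \<times> carrier X"
      by (rule keys_frag_map_subset[OF d']) (use fc in auto)
    moreover have "Poly_Mapping.keys (frag_map f (\<lambda>x. x) c) \<subseteq> carrier M' \<times> carrier X"
      by (rule keys_frag_map_subset[OF c]) (use fc in auto)
    moreover have "frag_map f (\<lambda>x. x) d - frag_map f (\<lambda>x. x) c \<in> tensor_kernel R M' X"
      using frag_map_tensor_kernel[OF M(1,2,3,2) f mod_hom_id k(1)] k(2) by simp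
    ultimately show ?thesis by (rule tensor_class_eq_iff[OF M(3,2), THEN iffD2])
  qed
  then have "tensor_map R f M' X (tensor_class R M X c)
      = (\<Union>d\<in>tensor_class R M X c. tensor_class R M' X (frag_map f (\<lambda>x. x) c))"
    unfolding tensor_map_def by (intro SUP_cong refl)
  moreover have "tensor_class R M X c \<noteq> {}"
    using group.rcos_self[OF group_free_Abelian_group _ K, of c] c by auto
  ultimately show ?thesis by simp
qed

lemma tensor_map_hom:
  assumes M: "module R M" "module R X" "module R M'" and f: "mod_hom R M M' f"
  shows "tensor_map R f M' X \<in> hom (tensor R M X) (tensor R M' X)"
proof (rule homI)
  have fc: "a \<in> carrier M \<Longrightarrow> f a \<in> carrier M'" for a using f by (auto simp: mod_hom_def)
  have k: "Poly_Mapping.keys (frag_map f (\<lambda>x. x) c) \<subseteq> carrier M' \<times> carrier X"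
    if "Poly_Mapping.keys c \<subseteq> carrier M \<times> carrier X" for c
    by (rule keys_frag_map_subset[OF that]) (use fc in auto)
  show "tensor_map R f M' X u \<in> carrier (tensor R M' X)" if "u \<in> carrier (tensor R M X)" for u
    using that k tensor_map_class[OF M f] unfolding carrier_tensor by auto
  fix u v assume "u \<in> carrier (tensor R M X)" "v \<in> carrier (tensor R M X)"
  then obtain c d where c: "Poly_Mapping.keys c \<subseteq> carrier M \<times> carrier X" "u = tensor_class R M X c"
      and d: "Poly_Mapping.keys d \<subseteq> carrier M \<times> carrier X" "v = tensor_class R M X d"
    unfolding carrier_tensor by auto
  show "tensor_map R f M' X (u \<otimes>\<^bsub>tensor R M X\<^esub> v)
      = tensor_map R f M' X u \<otimes>\<^bsub>tensor R M' X\<^esub> tensor_map R f M' X v"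
    using c d k by (simp add: tensor_class_add[OF M(1,2)] tensor_class_add[OF M(3,2)]
        tensor_map_class[OF M f] keys_add_subset)
qed

(* Surjectivity on the right and the inclusion of the image in the kernel hold for every N. *)
lemma exact_after_tensor_iff:
  fixes R :: "('r, 'p) ring_scheme" and M :: "('r, 'b, 'm) module_scheme"
    and X :: "('r, 'e, 'n) module_scheme"
  assumes M: "module R M" "submodule N R M" and X: "module R X"
  shows "exact_after_tensor R M N X \<longleftrightarrow>
    (\<forall>c. Poly_Mapping.keys c \<subseteq> N \<times> carrier X \<longrightarrow> c \<in> tensor_kernel R M X \<longrightarrow>
       c \<in> tensor_kernel R (M\<lparr>carrier := N\<rparr>) X) \<and>
    (\<forall>c. Poly_Mapping.keys c \<subseteq> carrier M \<times> carrier X \<longrightarrow>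
       frag_map (\<lambda>a. N +>\<^bsub>M\<^esub> a) (\<lambda>x. x) c \<in> tensor_kernel R (quotient_module M N) X \<longrightarrow>
       (\<exists>d. Poly_Mapping.keys d \<subseteq> N \<times> carrier X \<and> c - d \<in> tensor_kernel R M X))"
    (is "_ \<longleftrightarrow> ?A \<and> ?B")
proof -
  let ?N = "M\<lparr>carrier := N\<rparr>" and ?Q = "quotient_module M N" and ?p = "\<lambda>a. N +>\<^bsub>M\<^esub> a"
  let ?i = "tensor_map R (\<lambda>a. a) M X" and ?q = "tensor_map R ?p ?Q X"
  have N: "module R ?N" using submodule.submodule_is_module[OF M(2,1)] .
  note Q = quotient_module_is_module[OF M]
  have Nc: "N \<subseteq> carrier M" using module.submoduleE(1)[OF M] .
  have i: "mod_hom R ?N M (\<lambda>a. a)" using Nc by (auto simp: mod_hom_def)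
  have sub: "Poly_Mapping.keys c \<subseteq> carrier M \<times> carrier X"
    if "Poly_Mapping.keys c \<subseteq> N \<times> carrier X" for c :: "'b \<times> 'e \<Rightarrow>\<^sub>0 int"
    using that Nc by blast
  have pk: "Poly_Mapping.keys (frag_map ?p (\<lambda>x. x) c) \<subseteq> carrier ?Q \<times> carrier X"
    if "Poly_Mapping.keys c \<subseteq> carrier M \<times> carrier X" for c :: "'b \<times> 'e \<Rightarrow>\<^sub>0 int"
    by (rule keys_frag_map_subset[OF that]) (auto simp: Q(3))
  have ic: "?i (tensor_class R ?N X c) = tensor_class R M X c"
    if "Poly_Mapping.keys c \<subseteq> N \<times> carrier X" for c
    using tensor_map_class[OF N X M(1) i, of c] that by (simp add: frag_map_id)
  have qc: "?q (tensor_class R M X c) = tensor_class R ?Q X (frag_map ?p (\<lambda>x. x) c)"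
    if "Poly_Mapping.keys c \<subseteq> carrier M \<times> carrier X" for c
    using tensor_map_class[OF M(1) X Q(1,2) that] .
  note ih = tensor_map_hom[OF N X M(1) i] and qh = tensor_map_hom[OF M(1) X Q(1,2)]
  note grp = tensor_group[OF N X] tensor_group[OF M(1) X] tensor_group[OF Q(1) X]
  have Ncar: "carrier (tensor R ?N X) = tensor_class R ?N X ` {c. Poly_Mapping.keys c \<subseteq> N \<times> carrier X}"
    using carrier_tensor[of R ?N X] by simp
  have mon: "?i \<in> mon (tensor R ?N X) (tensor R M X) \<longleftrightarrow> ?A"
  proof
    assume L: "?i \<in> mon (tensor R ?N X) (tensor R M X)"
    show ?A
    proof (intro allI impI)
      fix c assume c: "Poly_Mapping.keys c \<subseteq> N \<times> carrier X" "c \<in> tensor_kernel R M X"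
      have "?i (tensor_class R ?N X c) = ?i (tensor_class R ?N X 0)"
        using c sub[OF c(1)] ic[OF c(1)] ic[of 0] tensor_class_eq_iff[OF M(1) X, of c 0] by simp
      moreover have "tensor_class R ?N X c \<in> carrier (tensor R ?N X)"
        "tensor_class R ?N X 0 \<in> carrier (tensor R ?N X)" unfolding Ncar using c by auto
      ultimately have "tensor_class R ?N X c = tensor_class R ?N X 0"
        using L by (simp add: mon_def inj_on_def)
      then show "c \<in> tensor_kernel R ?N X"
        using c tensor_class_eq_iff[OF N X, of c 0] by simp
    qed
  next
    assume A: ?A
    have "inj_on ?i (carrier (tensor R ?N X))"
      unfolding Ncar
    proof (rule inj_onI, clarify)
      fix c d assume cd: "Poly_Mapping.keys c \<subseteq> N \<times> carrier X" "Poly_Mapping.keys d \<subseteq> N \<times> carrier X"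
        "?i (tensor_class R ?N X c) = ?i (tensor_class R ?N X d)"
      then have "c - d \<in> tensor_kernel R M X"
        using sub[OF cd(1)] sub[OF cd(2)] ic[OF cd(1)] ic[OF cd(2)]
          tensor_class_eq_iff[OF M(1) X, of c d] by simp
      then have "c - d \<in> tensor_kernel R ?N X" using A keys_diff_subset[OF cd(1,2)] by simp
      then show "tensor_class R ?N X c = tensor_class R ?N X d"
        using tensor_class_eq_iff[OF N X, of c d] cd by simp
    qed
    then show "?i \<in> mon (tensor R ?N X) (tensor R M X)" using ih by (simp add: mon_def)
  qed
  have lift: "\<exists>c. Poly_Mapping.keys c \<subseteq> carrier M \<times> carrier X \<and> frag_map ?p (\<lambda>x. x) c = e"
    if "Poly_Mapping.keys e \<subseteq> carrier ?Q \<times> carrier X" for e :: "'b set \<times> 'e \<Rightarrow>\<^sub>0 int"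
    using that
  proof (induction e rule: frag_induction)
    case zero show ?case by (intro exI[of _ 0]) simp
  next
    case (diff x y) then show ?case by (metis frag_map_simps(5) keys_diff_subset)
  next
    case (one u)
    then obtain a x where "u = (?p a, x)" "a \<in> carrier M" "x \<in> carrier X" using Q(3) by auto
    then show ?case by (intro exI[of _ "frag_of (a, x)"]) simp
  qed
  have epi: "?q \<in> epi (tensor R M X) (tensor R ?Q X)"
    unfolding epi_iff_subset
  proof (intro conjI qh subsetI)
    fix u assume "u \<in> carrier (tensor R ?Q X)"
    then obtain e where e: "Poly_Mapping.keys e \<subseteq> carrier ?Q \<times> carrier X" "u = tensor_class R ?Q X e"
      unfolding carrier_tensor by auto
    then obtain c where "Poly_Mapping.keys c \<subseteq> carrier M \<times> carrier X" "frag_map ?p (\<lambda>x. x) c = e"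
      using lift by blast
    then have "u = ?q (tensor_class R M X c)" "tensor_class R M X c \<in> carrier (tensor R M X)"
      using e qc by (auto simp: carrier_tensor)
    then show "u \<in> ?q ` carrier (tensor R M X)" by blast
  qed
  have ker: "kernel (tensor R M X) (tensor R ?Q X) ?q =
     tensor_class R M X ` {c. Poly_Mapping.keys c \<subseteq> carrier M \<times> carrier X \<and>
       frag_map ?p (\<lambda>x. x) c \<in> tensor_kernel R ?Q X}" (is "_ = ?K")
  proof -
    have "?q (tensor_class R M X c) = \<one>\<^bsub>tensor R ?Q X\<^esub> \<longleftrightarrow> frag_map ?p (\<lambda>x. x) c \<in> tensor_kernel R ?Q X"
      if "Poly_Mapping.keys c \<subseteq> carrier M \<times> carrier X" for c
      using tensor_class_eq_iff[OF Q(1) X pk[OF that], of 0] qc[OF that] tensor_one[OF Q(1) X] by simp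
    then show ?thesis by (simp only: kernel_def carrier_tensor) blast
  qed
  have im: "?i ` carrier (tensor R ?N X) = tensor_class R M X ` {c. Poly_Mapping.keys c \<subseteq> N \<times> carrier X}"
    unfolding Ncar image_image by (rule image_cong[OF refl], rule ic) blast
  have p0: "frag_map ?p (\<lambda>x. x) c \<in> tensor_kernel R ?Q X" if "Poly_Mapping.keys c \<subseteq> N \<times> carrier X" for c
  proof -
    interpret Q: module R ?Q by (rule Q)
    interpret M: module R M by (rule M)
    have gen0: "frag_of (?p a, x) \<in> tensor_kernel R ?Q X" if "a \<in> N" "x \<in> carrier X" for a x
    proof -
      have ac: "a \<in> carrier M" using that Nc by auto
      have "?p a = \<zero>\<^bsub>?Q\<^esub>"
        using M.a_coset_join2[of a N] ac that submodule.axioms(1)[OF M(2)] 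
        by (simp add: quotient_module_def)
      moreover have "frag_of (\<zero>\<^bsub>?Q\<^esub> \<oplus>\<^bsub>?Q\<^esub> \<zero>\<^bsub>?Q\<^esub>, x) - frag_of (\<zero>\<^bsub>?Q\<^esub>, x) - frag_of (\<zero>\<^bsub>?Q\<^esub>, x)
          \<in> tensor_kernel R ?Q X"
        by (rule tensor_kernel_rel[OF tensor_relsI(1)]) (use that in auto)
      ultimately show ?thesis using tensor_kernel_minus[OF Q(1) X] by force
    qed
    show ?thesis using that
    proof (induction c rule: frag_induction)
      case (diff c d)
      then show ?case
        using tensor_kernel_add[OF _ tensor_kernel_minus[OF Q(1) X]] by fastforce
    qed (use gen0 in \<open>auto simp: tensor_kernel_zero\<close>)
  qed
  have ex: "?i ` carrier (tensor R ?N X) = kernel (tensor R M X) (tensor R ?Q X) ?q \<longleftrightarrow> ?B"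
  proof -
    have "?i ` carrier (tensor R ?N X) \<subseteq> ?K" unfolding im using p0 sub by blast
    moreover have "?K \<subseteq> ?i ` carrier (tensor R ?N X) \<longleftrightarrow> ?B"
    proof -
      have e: "tensor_class R M X c \<in> ?i ` carrier (tensor R ?N X) \<longleftrightarrow>
          (\<exists>d. Poly_Mapping.keys d \<subseteq> N \<times> carrier X \<and> c - d \<in> tensor_kernel R M X)"
        if "Poly_Mapping.keys c \<subseteq> carrier M \<times> carrier X" for c
        unfolding im image_iff using tensor_class_eq_iff[OF M(1) X that] sub by auto
      show ?thesis
      proof
        assume L: "?K \<subseteq> ?i ` carrier (tensor R ?N X)"
        show ?B
        proof (intro allI impI)
          fix c assume c: "Poly_Mapping.keys c \<subseteq> carrier M \<times> carrier X"
            "frag_map ?p (\<lambda>x. x) c \<in> tensor_kernel R ?Q X"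
          then have "tensor_class R M X c \<in> ?i ` carrier (tensor R ?N X)"
            by (intro subsetD[OF L] imageI CollectI conjI)
          then show "\<exists>d. Poly_Mapping.keys d \<subseteq> N \<times> carrier X \<and> c - d \<in> tensor_kernel R M X"
            by (rule e[OF c(1), THEN iffD1])
        qed
      next
        assume B: ?B
        show "?K \<subseteq> ?i ` carrier (tensor R ?N X)"
        proof (rule image_subsetI, elim CollectE conjE)
          fix c assume c: "Poly_Mapping.keys c \<subseteq> carrier M \<times> carrier X"
            "frag_map ?p (\<lambda>x. x) c \<in> tensor_kernel R ?Q X"
          show "tensor_class R M X c \<in> ?i ` carrier (tensor R ?N X)"
            by (rule e[OF c(1), THEN iffD2]) (rule B[rule_format, OF c])
        qed
      qed
    qed
    ultimately show ?thesis unfolding ker set_eq_subset by (simp only: simp_thms)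
  qed
  show ?thesis
    unfolding exact_after_tensor_def short_exact_def
    by (simp only: grp mon epi ex simp_thms)
qed

lemma small_test_module:
  fixes R :: "('r, 'p) ring_scheme" and X :: "('r, 'x, 'n) module_scheme"
  assumes X: "module R X" and S: "finite S" "S \<subseteq> carrier X"
  obtains U :: "('r, (nat \<Rightarrow> 'r) set) module" and \<sigma> \<tau> Y
  where "module R U" "submodule Y R X" "S \<subseteq> Y" "mod_hom R (X\<lparr>carrier := Y\<rparr>) U \<sigma>"
    "mod_hom R U X \<tau>" "\<And>y. y \<in> Y \<Longrightarrow> \<tau> (\<sigma> y) = y"
proof -
  obtain Y and \<sigma> :: "'x \<Rightarrow> (nat \<Rightarrow> 'r) set" where Y: "submodule Y R X" "S \<subseteq> Y" "inj_on \<sigma> Y"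
    using module.small_submodule[OF X S] by metis
  obtain U :: "('r, (nat \<Rightarrow> 'r) set) module" where U: "module R U"
    "mod_hom R (X\<lparr>carrier := Y\<rparr>) U \<sigma>" "mod_hom R U X (the_inv_into Y \<sigma>)"
    using module.transport_module[OF X Y(1,3)] by metis
  show thesis
    by (rule that[OF U(1) Y(1,2) U(2,3) the_inv_into_f_f[OF Y(3)]])
qed

lemma pure_submoduleD:
  fixes R :: "('r, 'p) ring_scheme" and M :: "('r, 'a, 'm) module_scheme"
    and X :: "('r, 'x, 'n) module_scheme"
  assumes M: "module R M" and pure: "pure_submodule R M N" and X: "module R X"
  shows "exact_after_tensor R M N X"
proof -
  let ?N = "M\<lparr>carrier := N\<rparr>" and ?Q = "quotient_module M N" and ?p = "\<lambda>a. N +>\<^bsub>M\<^esub> a"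
  have N: "submodule N R M" using pure by (simp add: pure_submodule_def)
  have Nm: "module R ?N" using submodule.submodule_is_module[OF N M] .
  note Q = quotient_module_is_module[OF M N]
  have Nc: "N \<subseteq> carrier M" using module.submoduleE(1)[OF M N] .
  show ?thesis
    unfolding exact_after_tensor_iff[OF M N X]
  proof (intro conjI allI impI)
    fix c :: "'a \<times> 'x \<Rightarrow>\<^sub>0 int"
    assume c: "Poly_Mapping.keys c \<subseteq> N \<times> carrier X" "c \<in> tensor_kernel R M X"
    obtain S where S: "finite S" "S \<subseteq> carrier X"
      "\<And>Y. submodule Y R X \<Longrightarrow> S \<subseteq> Y \<Longrightarrow> c \<in> tensor_kernel R M (X\<lparr>carrier := Y\<rparr>)"
      using tensor_kernel_finite[OF M X c(2)] by metis
    have fin: "finite (S \<union> snd ` Poly_Mapping.keys c)" "S \<union> snd ` Poly_Mapping.keys c \<subseteq> carrier X"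
      using S c by auto
    obtain U :: "('r, (nat \<Rightarrow> 'r) set) module" and \<sigma> \<tau> Y
      where U: "module R U" "submodule Y R X" "S \<subseteq> Y" "snd ` Poly_Mapping.keys c \<subseteq> Y"
        "mod_hom R (X\<lparr>carrier := Y\<rparr>) U \<sigma>" "mod_hom R U X \<tau>" "\<And>y. y \<in> Y \<Longrightarrow> \<tau> (\<sigma> y) = y"
      by (rule small_test_module[OF X fin]) auto
    have Ym: "module R (X\<lparr>carrier := Y\<rparr>)" using submodule.submodule_is_module[OF U(2) X] .
    have k: "Poly_Mapping.keys c \<subseteq> N \<times> Y" using c U(4) by force
    have "frag_map (\<lambda>a. a) \<sigma> c \<in> tensor_kernel R M U"
      using frag_map_tensor_kernel[OF M Ym M U(1) mod_hom_id U(5) S(3)[OF U(2,3)]] .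
    moreover have "Poly_Mapping.keys (frag_map (\<lambda>a. a) \<sigma> c) \<subseteq> N \<times> carrier U"
      by (rule keys_frag_map_subset[OF k]) (use U(5) in \<open>auto simp: mod_hom_def\<close>)
    moreover have "exact_after_tensor R M N U" using pure U(1) by (simp add: pure_submodule_def)
    ultimately have "frag_map (\<lambda>a. a) \<sigma> c \<in> tensor_kernel R ?N U"
      unfolding exact_after_tensor_iff[OF M N U(1)] by blast
    then have "frag_map (\<lambda>a. a) \<tau> (frag_map (\<lambda>a. a) \<sigma> c) \<in> tensor_kernel R ?N X"
      using frag_map_tensor_kernel[OF Nm U(1) Nm X mod_hom_id U(6)] by blast
    also have "frag_map (\<lambda>a. a) \<tau> (frag_map (\<lambda>a. a) \<sigma> c) = frag_map (\<lambda>a. a) (\<lambda>x. x) c"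
      unfolding frag_map_compose by (rule frag_map_cong) (use k U(7) in auto)
    finally show "c \<in> tensor_kernel R ?N X" by (simp add: frag_map_id)
  next
    fix c :: "'a \<times> 'x \<Rightarrow>\<^sub>0 int"
    let ?c = "frag_map ?p (\<lambda>x. x) c"
    assume c: "Poly_Mapping.keys c \<subseteq> carrier M \<times> carrier X" "?c \<in> tensor_kernel R ?Q X"
    obtain S where S: "finite S" "S \<subseteq> carrier X"
      "\<And>Y. submodule Y R X \<Longrightarrow> S \<subseteq> Y \<Longrightarrow> ?c \<in> tensor_kernel R ?Q (X\<lparr>carrier := Y\<rparr>)"
      using tensor_kernel_finite[OF Q(1) X c(2)] by metis
    have fin: "finite (S \<union> snd ` Poly_Mapping.keys c)" "S \<union> snd ` Poly_Mapping.keys c \<subseteq> carrier X"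
      using S c by auto
    obtain U :: "('r, (nat \<Rightarrow> 'r) set) module" and \<sigma> \<tau> Y
      where U: "module R U" "submodule Y R X" "S \<subseteq> Y" "snd ` Poly_Mapping.keys c \<subseteq> Y"
        "mod_hom R (X\<lparr>carrier := Y\<rparr>) U \<sigma>" "mod_hom R U X \<tau>" "\<And>y. y \<in> Y \<Longrightarrow> \<tau> (\<sigma> y) = y"
      by (rule small_test_module[OF X fin]) auto
    have Ym: "module R (X\<lparr>carrier := Y\<rparr>)" using submodule.submodule_is_module[OF U(2) X] .
    have k: "Poly_Mapping.keys c \<subseteq> carrier M \<times> Y" using c U(4) by force
    have "frag_map (\<lambda>a. a) \<sigma> ?c \<in> tensor_kernel R ?Q U"
      using frag_map_tensor_kernel[OF Q(1) Ym Q(1) U(1) mod_hom_id U(5) S(3)[OF U(2,3)]] .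
    also have "frag_map (\<lambda>a. a) \<sigma> ?c = frag_map ?p (\<lambda>x. x) (frag_map (\<lambda>a. a) \<sigma> c)"
      unfolding frag_map_compose by (rule frag_map_cong) auto
    finally have "frag_map ?p (\<lambda>x. x) (frag_map (\<lambda>a. a) \<sigma> c) \<in> tensor_kernel R ?Q U" .
    moreover have "Poly_Mapping.keys (frag_map (\<lambda>a. a) \<sigma> c) \<subseteq> carrier M \<times> carrier U"
      by (rule keys_frag_map_subset[OF k]) (use U(5) in \<open>auto simp: mod_hom_def\<close>)
    moreover have "exact_after_tensor R M N U" using pure U(1) by (simp add: pure_submodule_def)
    ultimately obtain d where d: "Poly_Mapping.keys d \<subseteq> N \<times> carrier U"
        "frag_map (\<lambda>a. a) \<sigma> c - d \<in> tensor_kernel R M U"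
      unfolding exact_after_tensor_iff[OF M N U(1)] by blast
    have "frag_map (\<lambda>a. a) \<tau> (frag_map (\<lambda>a. a) \<sigma> c - d) \<in> tensor_kernel R M X"
      using frag_map_tensor_kernel[OF M U(1) M X mod_hom_id U(6) d(2)] .
    moreover have "frag_map (\<lambda>a. a) \<tau> (frag_map (\<lambda>a. a) \<sigma> c) = frag_map (\<lambda>a. a) (\<lambda>x. x) c"
      unfolding frag_map_compose by (rule frag_map_cong) (use k U(7) in auto)
    ultimately have "c - frag_map (\<lambda>a. a) \<tau> d \<in> tensor_kernel R M X" by (simp add: frag_map_id)
    moreover have "Poly_Mapping.keys (frag_map (\<lambda>a. a) \<tau> d) \<subseteq> N \<times> carrier X"
      by (rule keys_frag_map_subset[OF d(1)]) (use U(6) in \<open>auto simp: mod_hom_def\<close>)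
    ultimately show "\<exists>d. Poly_Mapping.keys d \<subseteq> N \<times> carrier X \<and> c - d \<in> tensor_kernel R M X" by blast
  qed
qed


section \<open>Polyserial modules and Malcev rank\<close>

definition pure_composition_series ::
    "('r, 'p) ring_scheme \<Rightarrow> ('r, 'a, 'm) module_scheme \<Rightarrow> nat \<Rightarrow> (nat \<Rightarrow> 'a set) \<Rightarrow> bool" where
  "pure_composition_series R M n Ms \<longleftrightarrow>
     Ms 0 = {\<zero>\<^bsub>M\<^esub>} \<and> Ms n = carrier M \<and>
     (\<forall>k<n. Ms k \<subset> Ms (Suc k)) \<and>
     (\<forall>k\<le>n. pure_submodule R M (Ms k))"

definition uniserial_factors ::
    "('r, 'p) ring_scheme \<Rightarrow> ('r, 'a, 'm) module_scheme \<Rightarrow> nat \<Rightarrow> (nat \<Rightarrow> 'a set) \<Rightarrow> bool" where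
  "uniserial_factors R M n Ms \<longleftrightarrow>
     (\<forall>k<n. uniserial R (quotient_module (M\<lparr>carrier := Ms (Suc k)\<rparr>) (Ms k)))"

definition polyserial :: "('r, 'p) ring_scheme \<Rightarrow> ('r, 'a, 'm) module_scheme \<Rightarrow> bool" where
  "polyserial R M \<longleftrightarrow> module R M \<and>
     (\<exists>n Ms. pure_composition_series R M n Ms \<and> uniserial_factors R M n Ms)"

(* The infimum over the empty set is \<infinity>, so gen R M < \<infinity> says that M is finitely generated. *)
definition gen :: "('r, 'p) ring_scheme \<Rightarrow> ('r, 'a, 'm) module_scheme \<Rightarrow> enat" where
  "gen R M = Inf {enat (card S) | S. finite S \<and> S \<subseteq> carrier M \<and>
                                    (\<lambda>N. submodule N R M) hull S = carrier M}"

definition Malcev_rank :: "('r, 'p) ring_scheme \<Rightarrow> ('r, 'a, 'm) module_scheme \<Rightarrow> enat" where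
  "Malcev_rank R N =
     Sup {gen R (N\<lparr>carrier := A\<rparr>) | A. submodule A R N \<and> gen R (N\<lparr>carrier := A\<rparr>) < \<infinity>}"

end

theory Submission
  imports Defs
begin

text \<open>Write \<open>Ms 0 \<subset> \<dots> \<subset> Ms n\<close> for the series. Both inequalities between \<open>n\<close> and the Malcev rank
are statements about sets of elements of \<open>M\<close> that are irredundant, i.e. none of whose elements
lies in the span of the others, modulo some submodule.

The rank is at most \<open>n\<close>: a generating set of least size of a finitely generated submodule is
irredundant, and an irredundant set has at most \<open>n\<close> elements. Indeed, in a uniserial factor one of
finitely many elements generates all the others, so that elimination pushes all elements but one
into the next lower member of the series (\<open>card_irredundant_le_chain\<close>).

The rank is at least \<open>n\<close>: it suffices to find an irredundant set of \<open>n\<close> elements, since over a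
valuation ring the elimination argument, applied to the chain of spans of the first generators,
also shows that such a set does not lie in a submodule with fewer generators
(\<open>card_irredundant_le_generators\<close>). The set is built from the top: given a set \<open>X\<close> that is
irredundant modulo \<open>Ms k\<close>, an element of \<open>Ms k\<close> outside \<open>lspan (X \<union> Ms (k - 1))\<close> extends it to a
set irredundant modulo \<open>Ms (k - 1)\<close>. That such an element exists is the heart of the proof
(\<open>relatively_divisible_not_in_span\<close>). It is where purity enters, through its consequence that
\<open>r w \<in> Ms k\<close> implies \<open>r w \<in> r (Ms k)\<close>. If \<open>Ms k\<close> were contained in the span, every \<open>z \<in> Ms k\<close>
would be a combination of \<open>X\<close> modulo \<open>Ms (k - 1)\<close>. If \<open>q\<close> is the greatest common divisor of its
coefficients, purity allows correcting one generator by an element of \<open>Ms k\<close> so that \<open>q\<close>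
annihilates it; the corrected set still generates because the ring is local. In terms of the new
generators, \<open>z\<close> is \<open>q\<close> times a combination of the uncorrected ones, and the argument can be
repeated until none is left. Then \<open>z \<in> Ms (k - 1)\<close>, contradicting \<open>Ms (k - 1) \<subset> Ms k\<close>.\<close>

section \<open>Linear spans\<close>

context module begin

lemma submodule_zero:
  assumes "submodule H R M"
  shows "\<zero>\<^bsub>M\<^esub> \<in> H"
proof -
  obtain h where "h \<in> H" using submoduleE(2)[OF assms] by blast
  then have "h \<in> carrier M" "\<zero> \<odot>\<^bsub>M\<^esub> h \<in> H" using submoduleE(1,4)[OF assms] by auto
  then show ?thesis by simp
qed

lemma submodule_of_scalars:
  assumes "H \<subseteq> carrier M" "\<zero>\<^bsub>M\<^esub> \<in> H"
    and "\<And>a b. a \<in> H \<Longrightarrow> b \<in> H \<Longrightarrow> a \<oplus>\<^bsub>M\<^esub> b \<in> H"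
    and smult: "\<And>r a. r \<in> carrier R \<Longrightarrow> a \<in> H \<Longrightarrow> r \<odot>\<^bsub>M\<^esub> a \<in> H"
  shows "submodule H R M"
proof (rule submoduleI)
  fix a assume "a \<in> H"
  then have "a \<in> carrier M" "(\<ominus> \<one>) \<odot>\<^bsub>M\<^esub> a \<in> H" using assms by auto
  then show "\<ominus>\<^bsub>M\<^esub> a \<in> H" using smult_l_minus[of \<one> a] by simp
qed (use assms in auto)

lemma submodule_add_cancel:
  assumes "submodule H R M" "a \<oplus>\<^bsub>M\<^esub> b \<in> H" "b \<in> H" "a \<in> carrier M"
  shows "a \<in> H"
proof -
  have b: "b \<in> carrier M" using submoduleE(1)[OF assms(1)] assms(3) by auto
  have "(a \<oplus>\<^bsub>M\<^esub> b) \<oplus>\<^bsub>M\<^esub> \<ominus>\<^bsub>M\<^esub> b \<in> H" using submoduleE(3,5)[OF assms(1)] assms by auto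
  then show ?thesis using assms(4) b by (simp add: M.a_assoc M.r_neg)
qed

lemma submodule_smult_image:
  assumes "submodule N R M" "r \<in> carrier R"
  shows "submodule ((\<lambda>y. r \<odot>\<^bsub>M\<^esub> y) ` N) R M"
proof (rule submodule_of_scalars)
  let ?H = "(\<lambda>y. r \<odot>\<^bsub>M\<^esub> y) ` N"
  note N = submoduleE[OF assms(1)]
  show "?H \<subseteq> carrier M" using N(1) assms(2) by auto
  show "\<zero>\<^bsub>M\<^esub> \<in> ?H" using submodule_zero[OF assms(1)] assms(2) by (intro image_eqI[of _ _ "\<zero>\<^bsub>M\<^esub>"]) auto
  fix a b assume "a \<in> ?H" "b \<in> ?H"
  then obtain u v where "u \<in> N" "v \<in> N" "a = r \<odot>\<^bsub>M\<^esub> u" "b = r \<odot>\<^bsub>M\<^esub> v" by auto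
  then show "a \<oplus>\<^bsub>M\<^esub> b \<in> ?H" using N(1,5) assms(2)
    by (intro image_eqI[of _ _ "u \<oplus>\<^bsub>M\<^esub> v"]) (auto simp: smult_r_distr subset_iff)
next
  let ?H = "(\<lambda>y. r \<odot>\<^bsub>M\<^esub> y) ` N"
  note N = submoduleE[OF assms(1)]
  fix q a assume q: "q \<in> carrier R" and "a \<in> ?H"
  then obtain u where u: "u \<in> N" "a = r \<odot>\<^bsub>M\<^esub> u" by auto
  then have uc: "u \<in> carrier M" using N(1) by auto
  have "q \<odot>\<^bsub>M\<^esub> a = r \<odot>\<^bsub>M\<^esub> (q \<odot>\<^bsub>M\<^esub> u)"
    using u(2) uc q assms(2) by (simp add: smult_assoc1[symmetric] R.m_comm)
  then show "q \<odot>\<^bsub>M\<^esub> a \<in> ?H" using N(4)[OF q u(1)] by blast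
qed

definition lspan :: "'c set \<Rightarrow> 'c set" where
  "lspan S = (\<lambda>H. submodule H R M) hull S"

lemma submodule_lspan:
  assumes "S \<subseteq> carrier M"
  shows "submodule (lspan S) R M"
proof (rule submodule_of_scalars)
  show "lspan S \<subseteq> carrier M"
    unfolding lspan_def by (rule hull_minimal) (simp_all add: assms carrier_is_submodule)
qed (auto simp: lspan_def hull_def intro: submodule_zero submoduleE)

lemma lspan_minimal: "S \<subseteq> H \<Longrightarrow> submodule H R M \<Longrightarrow> lspan S \<subseteq> H"
  unfolding lspan_def by (rule hull_minimal)

lemma lspan_base: "x \<in> S \<Longrightarrow> x \<in> lspan S"
  unfolding lspan_def by (rule hull_inc)

lemma lspan_superset: "S \<subseteq> lspan S"
  unfolding lspan_def by (rule hull_subset)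

lemma lspan_mono: "S \<subseteq> T \<Longrightarrow> lspan S \<subseteq> lspan T"
  unfolding lspan_def by (rule hull_mono)

lemma lspan_subset_carrier: "S \<subseteq> carrier M \<Longrightarrow> lspan S \<subseteq> carrier M"
  by (rule lspan_minimal) (simp_all add: carrier_is_submodule)

lemma lspan_le: "T \<subseteq> carrier M \<Longrightarrow> S \<subseteq> lspan T \<Longrightarrow> lspan S \<subseteq> lspan T"
  by (rule lspan_minimal) (simp_all add: submodule_lspan)

lemma lspan_of_submodule: "submodule H R M \<Longrightarrow> lspan H = H"
  using lspan_minimal[of H H] lspan_superset[of H] by blast

lemma lspan_empty: "lspan {} = {\<zero>\<^bsub>M\<^esub>}"
proof
  have "submodule {\<zero>\<^bsub>M\<^esub>} R M" by (rule submodule_of_scalars) auto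
  then show "lspan {} \<subseteq> {\<zero>\<^bsub>M\<^esub>}" by (intro lspan_minimal) auto
  show "{\<zero>\<^bsub>M\<^esub>} \<subseteq> lspan {}" using submodule_zero[OF submodule_lspan] by auto
qed

lemma lspan_UnE:
  assumes "S \<subseteq> carrier M" "T \<subseteq> carrier M" "z \<in> lspan (S \<union> T)"
  obtains a b where "a \<in> lspan S" "b \<in> lspan T" "z = a \<oplus>\<^bsub>M\<^esub> b"
proof -
  let ?H = "{a \<oplus>\<^bsub>M\<^esub> b | a b. a \<in> lspan S \<and> b \<in> lspan T}"
  note S = submodule_lspan[OF assms(1)] and T = submodule_lspan[OF assms(2)]
  note Sc = submoduleE(1)[OF S] and Tc = submoduleE(1)[OF T]
  have "submodule ?H R M"
  proof (rule submodule_of_scalars)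
    show "?H \<subseteq> carrier M" using Sc Tc by auto
    show "\<zero>\<^bsub>M\<^esub> \<in> ?H" using submodule_zero[OF S] submodule_zero[OF T]
      by (intro CollectI exI[of _ "\<zero>\<^bsub>M\<^esub>"]) simp
    fix u v assume "u \<in> ?H" "v \<in> ?H"
    then obtain a b c d where *: "u = a \<oplus>\<^bsub>M\<^esub> b" "v = c \<oplus>\<^bsub>M\<^esub> d"
      "a \<in> lspan S" "b \<in> lspan T" "c \<in> lspan S" "d \<in> lspan T" by blast
    then have cl: "a \<in> carrier M" "b \<in> carrier M" "c \<in> carrier M" "d \<in> carrier M" using Sc Tc by auto
    have "u \<oplus>\<^bsub>M\<^esub> v = (a \<oplus>\<^bsub>M\<^esub> c) \<oplus>\<^bsub>M\<^esub> (b \<oplus>\<^bsub>M\<^esub> d)" using * cl by (simp add: M.a_ac)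
    then show "u \<oplus>\<^bsub>M\<^esub> v \<in> ?H" using * submoduleE(5)[OF S] submoduleE(5)[OF T] by blast
  next
    fix r u assume r: "r \<in> carrier R" and "u \<in> ?H"
    then obtain a b where *: "u = a \<oplus>\<^bsub>M\<^esub> b" "a \<in> lspan S" "b \<in> lspan T" by blast
    then have cl: "a \<in> carrier M" "b \<in> carrier M" using Sc Tc by auto
    have "r \<odot>\<^bsub>M\<^esub> u = r \<odot>\<^bsub>M\<^esub> a \<oplus>\<^bsub>M\<^esub> r \<odot>\<^bsub>M\<^esub> b" using * cl r by (simp add: smult_r_distr)
    then show "r \<odot>\<^bsub>M\<^esub> u \<in> ?H" using * r submoduleE(4)[OF S] submoduleE(4)[OF T] by blast
  qed
  moreover have "S \<union> T \<subseteq> ?H"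
  proof
    fix u assume u: "u \<in> S \<union> T"
    then have "u = u \<oplus>\<^bsub>M\<^esub> \<zero>\<^bsub>M\<^esub>" "u = \<zero>\<^bsub>M\<^esub> \<oplus>\<^bsub>M\<^esub> u" using assms by auto
    then show "u \<in> ?H"
      using u lspan_base submodule_zero[OF S] submodule_zero[OF T] by blast
  qed
  ultimately have "lspan (S \<union> T) \<subseteq> ?H" by (intro lspan_minimal)
  then show thesis using assms(3) that by blast
qed

lemma lspan_singletonE:
  assumes "x \<in> carrier M" "z \<in> lspan {x}"
  obtains r where "r \<in> carrier R" "z = r \<odot>\<^bsub>M\<^esub> x"
proof -
  let ?H = "{r \<odot>\<^bsub>M\<^esub> x | r. r \<in> carrier R}"
  have "submodule ?H R M"
  proof (rule submodule_of_scalars)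
    show "\<zero>\<^bsub>M\<^esub> \<in> ?H" using assms(1) smult_l_null[of x] by (metis (mono_tags, lifting) CollectI R.zero_closed)
    fix u v assume "u \<in> ?H" "v \<in> ?H"
    then show "u \<oplus>\<^bsub>M\<^esub> v \<in> ?H" using assms(1) smult_l_distr[symmetric] by blast
  next
    fix r u assume "r \<in> carrier R" "u \<in> ?H"
    then show "r \<odot>\<^bsub>M\<^esub> u \<in> ?H" using assms(1) smult_assoc1[symmetric] by blast
  qed (use assms in auto)
  moreover have "x \<in> ?H" using assms(1) by (metis (mono_tags, lifting) CollectI R.one_closed smult_one)
  ultimately have "lspan {x} \<subseteq> ?H" by (intro lspan_minimal) auto
  then show thesis using assms(2) that by blast
qed

lemma lspan_insertE:
  assumes "x \<in> carrier M" "S \<subseteq> carrier M" "z \<in> lspan (insert x S)"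
  obtains r a where "r \<in> carrier R" "a \<in> lspan S" "z = r \<odot>\<^bsub>M\<^esub> x \<oplus>\<^bsub>M\<^esub> a"
proof -
  have "z \<in> lspan ({x} \<union> S)" "{x} \<subseteq> carrier M" using assms by auto
  then obtain a b where "a \<in> lspan {x}" "b \<in> lspan S" "z = a \<oplus>\<^bsub>M\<^esub> b"
    using lspan_UnE assms(2) by metis
  then show thesis using lspan_singletonE[OF assms(1)] that by metis
qed

lemma smult_lspan_mem:
  assumes "submodule L R M" "q \<in> carrier R" "S \<subseteq> carrier M" "\<And>x. x \<in> S \<Longrightarrow> q \<odot>\<^bsub>M\<^esub> x \<in> L"
    "u \<in> lspan S"
  shows "q \<odot>\<^bsub>M\<^esub> u \<in> L"
proof -
  let ?H = "{u \<in> carrier M. q \<odot>\<^bsub>M\<^esub> u \<in> L}"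
  have "submodule ?H R M"
  proof (rule submodule_of_scalars)
    fix r u assume r: "r \<in> carrier R" and u: "u \<in> ?H"
    have "q \<odot>\<^bsub>M\<^esub> (r \<odot>\<^bsub>M\<^esub> u) = r \<odot>\<^bsub>M\<^esub> (q \<odot>\<^bsub>M\<^esub> u)"
      using r u assms(2) by (simp add: smult_assoc1[symmetric] R.m_comm)
    then show "r \<odot>\<^bsub>M\<^esub> u \<in> ?H" using r u submoduleE(4)[OF assms(1)] by auto
  qed (use assms submodule_zero[OF assms(1)] submoduleE(5)[OF assms(1)] in \<open>auto simp: smult_r_distr\<close>)
  then have "lspan S \<subseteq> ?H" using assms by (intro lspan_minimal) auto
  then show ?thesis using assms(5) by blast
qed

section \<open>Irredundant sets\<close>

text \<open>Irredundance in \<open>M / N\<close>, stated inside \<open>M\<close>: an induction that passes to successive quotient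
modules would change the type of the elements at every step.\<close>
definition irredundant :: "'c set \<Rightarrow> 'c set \<Rightarrow> bool" where
  "irredundant N X \<longleftrightarrow> X \<subseteq> carrier M \<and> (\<forall>x\<in>X. x \<notin> lspan ((X - {x}) \<union> N))"

text \<open>Elimination, as in the exchange lemma for vector spaces. Comparability makes some \<open>x0 \<in> X\<close>
generate all of \<open>X\<close> modulo the penultimate member of the chain, so that subtracting multiples of
\<open>x0\<close> moves the other elements down by one step. These stay distinct and irredundant, because \<open>x0\<close>
remains available for expressing the original elements. The hypothesis on the steps holds both for
chains with uniserial factors and for chains obtained by adding one generator at a time over a
valuation ring.\<close>
lemma card_irredundant_le_chain:
  assumes D: "\<And>i. i \<le> k \<Longrightarrow> submodule (D i) R M"
    and step: "\<And>i x y. i < k \<Longrightarrow> x \<in> D (Suc i) \<Longrightarrow> y \<in> D (Suc i) \<Longrightarrow>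
      x \<in> lspan (insert y (D i)) \<or> y \<in> lspan (insert x (D i))"
    and X: "finite X" "irredundant (D 0) X" "X \<subseteq> D k"
  shows "card X \<le> k"
  using assms
proof (induction k arbitrary: X)
  case 0
  have "X = {}"
    using 0(4,5) lspan_base unfolding irredundant_def by blast
  then show ?case by simp
next
  case (Suc k)
  show ?case
  proof (cases "X = {}")
    case False
    have Dc: "D i \<subseteq> carrier M" if "i \<le> Suc k" for i using Suc.prems(1) submoduleE(1) that by blast
    have Xc: "X \<subseteq> carrier M" using Suc.prems(4) by (simp add: irredundant_def)
    have "\<exists>x0\<in>Y. \<forall>x\<in>Y. x \<in> lspan (insert x0 (D k))" if "finite Y" "Y \<noteq> {}" "Y \<subseteq> X" for Y
      using that
    proof (induction Y rule: finite_ne_induct)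
      case (singleton x) then show ?case using lspan_base by blast
    next
      case (insert x Y)
      then obtain x0 where x0: "x0 \<in> Y" "\<And>y. y \<in> Y \<Longrightarrow> y \<in> lspan (insert x0 (D k))" by blast
      have sub: "insert u (D k) \<subseteq> carrier M" if "u \<in> X" for u using that Xc Dc[of k] by auto
      have "x \<in> X" "x0 \<in> X" using insert.prems x0 by auto
      then consider "x \<in> lspan (insert x0 (D k))" | "x0 \<in> lspan (insert x (D k))"
        using Suc.prems(2)[of k x x0] Suc.prems(5) by auto
      then show ?case
      proof cases
        case 1 then show ?thesis using x0 by blast
      next
        case 2
        have "insert x0 (D k) \<subseteq> lspan (insert x (D k))" using 2 lspan_base by blast
        then have "lspan (insert x0 (D k)) \<subseteq> lspan (insert x (D k))"
          by (rule lspan_le[OF sub[OF \<open>x \<in> X\<close>]])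
        then show ?thesis using x0 lspan_base by blast
      qed
    qed
    \<comment> \<open>A finite nonempty set with a total preorder has a greatest element.\<close>
    from this[OF Suc.prems(3) False subset_refl]
    obtain x0 where x0: "x0 \<in> X" "\<And>x. x \<in> X \<Longrightarrow> x \<in> lspan (insert x0 (D k))" by blast
    have x0c: "x0 \<in> carrier M" using x0 Xc by auto
    have "\<exists>t\<in>carrier R. x \<oplus>\<^bsub>M\<^esub> t \<odot>\<^bsub>M\<^esub> x0 \<in> D k" if x: "x \<in> X" for x
    proof -
      obtain r a where ra: "r \<in> carrier R" "a \<in> lspan (D k)" "x = r \<odot>\<^bsub>M\<^esub> x0 \<oplus>\<^bsub>M\<^esub> a"
        using lspan_insertE[OF x0c Dc[of k] x0(2)[OF x]] by auto
      have a: "a \<in> D k" using ra(2) lspan_of_submodule[OF Suc.prems(1)[of k]] by simp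
      then have "a \<in> carrier M" using Dc[of k] by auto
      then have "x \<oplus>\<^bsub>M\<^esub> (\<ominus> r) \<odot>\<^bsub>M\<^esub> x0 = a"
        using ra x0c by (simp add: smult_l_minus M.a_ac M.r_neg1 M.r_neg)
      then show ?thesis using a ra(1) by (intro bexI[of _ "\<ominus> r"]) auto
    qed
    then obtain t where t: "\<And>x. x \<in> X \<Longrightarrow> t x \<in> carrier R"
      "\<And>x. x \<in> X \<Longrightarrow> x \<oplus>\<^bsub>M\<^esub> t x \<odot>\<^bsub>M\<^esub> x0 \<in> D k" by metis
    define y where "y x = x \<oplus>\<^bsub>M\<^esub> t x \<odot>\<^bsub>M\<^esub> x0" for x
    have yc: "y x \<in> carrier M" if "x \<in> X" for x using that Xc t(1) x0c by (auto simp: y_def)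
    let ?X = "X - {x0}"
    have indep: "y x \<notin> lspan (y ` (?X - {x}) \<union> D 0)" if x: "x \<in> ?X" for x
    proof
      let ?S = "(X - {x}) \<union> D 0"
      have Sc: "?S \<subseteq> carrier M" using Xc Dc[of 0] by auto
      note S = submoduleE[OF submodule_lspan[OF Sc]]
      have "x0 \<in> lspan ?S" using x x0 by (intro lspan_base) auto
      then have tx0: "t u \<odot>\<^bsub>M\<^esub> x0 \<in> lspan ?S" if "u \<in> X" for u using S(4) t(1) that by blast
      have "y u \<in> lspan ?S" if "u \<in> ?X - {x}" for u
        unfolding y_def using that tx0 lspan_base[of u ?S] by (intro S(5)) auto
      then have "lspan (y ` (?X - {x}) \<union> D 0) \<subseteq> lspan ?S"
        by (intro lspan_le[OF Sc]) (auto intro: lspan_base)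
      moreover assume "y x \<in> lspan (y ` (?X - {x}) \<union> D 0)"
      ultimately have "x \<in> lspan ?S"
        using submodule_add_cancel[OF submodule_lspan[OF Sc], of x "t x \<odot>\<^bsub>M\<^esub> x0"] tx0 x Xc
        by (auto simp: y_def)
      then show False using Suc.prems(4) x by (auto simp: irredundant_def)
    qed
    have inj: "inj_on y ?X"
    proof (rule inj_onI, rule ccontr)
      fix u v assume "u \<in> ?X" "v \<in> ?X" and uv: "y u = y v" "u \<noteq> v"
      then have "y u \<in> y ` (?X - {u}) \<union> D 0" unfolding uv(1) by blast
      from lspan_base[OF this] show False using indep[OF \<open>u \<in> ?X\<close>] by simp
    qed
    have eq: "y ` ?X - {y x} = y ` (?X - {x})" if "x \<in> ?X" for x
      using inj that by (auto simp: inj_on_def)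
    have "card (y ` ?X) \<le> k"
    proof (rule Suc.IH)
      show "irredundant (D 0) (y ` ?X)"
        unfolding irredundant_def using yc indep eq by auto
    qed (use Suc.prems t in \<open>auto simp: y_def\<close>)
    then have "card ?X \<le> k" using card_image[OF inj] by simp
    then show ?thesis using x0(1) Suc.prems(3) by simp
  qed simp
qed

end

section \<open>Divisibility in valuation rings\<close>

lemma module_regular_module:
  assumes "cring R"
  shows "module R (regular_module R)"
proof -
  interpret R: cring R by fact
  show ?thesis
  proof (rule moduleI)
    show "abelian_group (regular_module R)"
    proof (rule abelian_groupI)
      fix x assume "x \<in> carrier (regular_module R)"
      then show "\<exists>y\<in>carrier (regular_module R). y \<oplus>\<^bsub>regular_module R\<^esub> x = \<zero>\<^bsub>regular_module R\<^esub>"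
        by (intro bexI[of _ "\<ominus>\<^bsub>R\<^esub> x"]) (auto simp: regular_module_def R.l_neg)
    qed (auto simp: regular_module_def R.a_ac)
  qed (auto simp: regular_module_def R.l_distr R.r_distr R.m_assoc assms)
qed

lemma submodule_principal:
  assumes "cring R" "r \<in> carrier R"
  shows "submodule ((\<lambda>s. r \<otimes>\<^bsub>R\<^esub> s) ` carrier R) R (regular_module R)"
proof -
  interpret module R "regular_module R" by (rule module_regular_module) fact
  show ?thesis
    using submodule_smult_image[OF carrier_is_submodule assms(2)] by (simp add: regular_module_def)
qed

lemma valuation_ring_divides:
  assumes "valuation_ring R" "a \<in> carrier R" "b \<in> carrier R"
  shows "(\<exists>e\<in>carrier R. a = b \<otimes>\<^bsub>R\<^esub> e) \<or> (\<exists>e\<in>carrier R. b = a \<otimes>\<^bsub>R\<^esub> e)"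
proof -
  interpret cring R using assms(1) by (simp add: valuation_ring_def)
  have "a \<otimes>\<^bsub>R\<^esub> \<one>\<^bsub>R\<^esub> \<in> (\<lambda>s. a \<otimes>\<^bsub>R\<^esub> s) ` carrier R" "b \<otimes>\<^bsub>R\<^esub> \<one>\<^bsub>R\<^esub> \<in> (\<lambda>s. b \<otimes>\<^bsub>R\<^esub> s) ` carrier R" by blast+
  moreover have "(\<lambda>s. a \<otimes>\<^bsub>R\<^esub> s) ` carrier R \<subseteq> (\<lambda>s. b \<otimes>\<^bsub>R\<^esub> s) ` carrier R \<or>
      (\<lambda>s. b \<otimes>\<^bsub>R\<^esub> s) ` carrier R \<subseteq> (\<lambda>s. a \<otimes>\<^bsub>R\<^esub> s) ` carrier R"
    using assms submodule_principal[OF is_cring] by (simp add: valuation_ring_def uniserial_def)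
  ultimately show ?thesis using assms by auto
qed

text \<open>Of two elements with sum \<open>\<one>\<close>, one divides the other and hence also divides \<open>\<one>\<close>.\<close>
lemma valuation_ring_local:
  assumes V: "valuation_ring R" and s: "s \<in> carrier R" "s \<notin> Units R"
  shows "\<one>\<^bsub>R\<^esub> \<ominus>\<^bsub>R\<^esub> s \<in> Units R"
proof -
  interpret cring R using V by (simp add: valuation_ring_def)
  let ?t = "\<one>\<^bsub>R\<^esub> \<ominus>\<^bsub>R\<^esub> s"
  have t: "?t \<in> carrier R" "?t \<oplus>\<^bsub>R\<^esub> s = \<one>\<^bsub>R\<^esub>" using s by (auto simp: minus_eq a_assoc l_neg)
  have unit: "u \<in> Units R"
    if "e \<in> carrier R" "u \<in> carrier R" "v \<in> carrier R" "u \<oplus>\<^bsub>R\<^esub> v = \<one>\<^bsub>R\<^esub>" "v = u \<otimes>\<^bsub>R\<^esub> e" for u v e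
  proof -
    have c: "\<one>\<^bsub>R\<^esub> \<oplus>\<^bsub>R\<^esub> e \<in> carrier R" using that by simp
    have "u \<otimes>\<^bsub>R\<^esub> (\<one>\<^bsub>R\<^esub> \<oplus>\<^bsub>R\<^esub> e) = \<one>\<^bsub>R\<^esub>"
      using that r_distr[of "\<one>\<^bsub>R\<^esub>" e u] by simp
    then show ?thesis using c that(2) m_comm[OF that(2) c] unfolding Units_def by auto
  qed
  have ts: "s \<oplus>\<^bsub>R\<^esub> ?t = \<one>\<^bsub>R\<^esub>" using t s a_comm by simp
  from valuation_ring_divides[OF V s(1) t(1)] show ?thesis
  proof (elim disjE bexE)
    fix e assume "e \<in> carrier R" "s = ?t \<otimes>\<^bsub>R\<^esub> e"
    then show ?thesis using unit t s by blast
  next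
    fix e assume "e \<in> carrier R" "?t = s \<otimes>\<^bsub>R\<^esub> e"
    then show ?thesis using unit t s ts by blast
  qed
qed

section \<open>Irredundant sets over a valuation ring\<close>

context module begin

text \<open>Modulo \<open>H\<close> both elements are multiples of \<open>s\<close>, and the coefficients are comparable by
divisibility.\<close>
lemma cyclic_extension_comparable:
  assumes V: "valuation_ring R" and H: "submodule H R M" and s: "s \<in> carrier M"
    and xy: "x \<in> lspan (insert s H)" "y \<in> lspan (insert s H)"
  shows "x \<in> lspan (insert y H) \<or> y \<in> lspan (insert x H)"
proof -
  have Hc: "H \<subseteq> carrier M" using submoduleE(1)[OF H] .
  obtain r a where x: "r \<in> carrier R" "a \<in> H" "x = r \<odot>\<^bsub>M\<^esub> s \<oplus>\<^bsub>M\<^esub> a"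
    using lspan_insertE[OF s Hc xy(1)] lspan_of_submodule[OF H] by metis
  obtain q b where y: "q \<in> carrier R" "b \<in> H" "y = q \<odot>\<^bsub>M\<^esub> s \<oplus>\<^bsub>M\<^esub> b"
    using lspan_insertE[OF s Hc xy(2)] lspan_of_submodule[OF H] by metis
  have multiple: "u \<in> lspan (insert v H)"
    if "t \<in> carrier R" "e \<in> carrier R" "c \<in> H" "d \<in> H" "v = t \<odot>\<^bsub>M\<^esub> s \<oplus>\<^bsub>M\<^esub> d"
      "u = (t \<otimes> e) \<odot>\<^bsub>M\<^esub> s \<oplus>\<^bsub>M\<^esub> c" for u v t e c d
  proof -
    have cl: "c \<in> carrier M" "d \<in> carrier M" using that Hc by auto
    then have v: "insert v H \<subseteq> carrier M" using that s Hc by auto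
    note S = submoduleE[OF submodule_lspan[OF v]]
    have "u \<oplus>\<^bsub>M\<^esub> e \<odot>\<^bsub>M\<^esub> d = e \<odot>\<^bsub>M\<^esub> v \<oplus>\<^bsub>M\<^esub> c"
      using that cl s by (simp add: smult_r_distr R.m_comm[of t e] smult_assoc1 M.a_ac)
    also have "\<dots> \<in> lspan (insert v H)"
      using that by (intro S(5) S(4) lspan_base) auto
    finally show ?thesis
    proof (rule submodule_add_cancel[OF submodule_lspan[OF v]])
      show "e \<odot>\<^bsub>M\<^esub> d \<in> lspan (insert v H)" using that by (intro S(4) lspan_base) auto
    qed (use that cl s in auto)
  qed
  from valuation_ring_divides[OF V x(1) y(1)] show ?thesis
  proof (elim disjE bexE)
    fix e assume "e \<in> carrier R" "r = q \<otimes> e"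
    then have "x \<in> lspan (insert y H)" using multiple[of q e a b y x] x y by simp
    then show ?thesis ..
  next
    fix e assume "e \<in> carrier R" "q = r \<otimes> e"
    then have "y \<in> lspan (insert x H)" using multiple[of r e b a x y] x y by simp
    then show ?thesis ..
  qed
qed

text \<open>The analogue of the Steinitz bound: adding the elements of \<open>Y\<close> to \<open>L\<close> one by one gives a
chain of length \<open>card Y\<close> whose steps are cyclic.\<close>
lemma card_irredundant_le_generators:
  assumes V: "valuation_ring R" and L: "submodule L R M"
    and Y: "finite Y" "Y \<subseteq> carrier M"
    and X: "finite X" "irredundant L X" "X \<subseteq> lspan (Y \<union> L)"
  shows "card X \<le> card Y"
proof -
  obtain ys where ys: "set ys = Y" "length ys = card Y"
    using finite_distinct_list[OF Y(1)] distinct_card by metis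
  define D where "D i = lspan (set (take i ys) \<union> L)" for i
  have Lc: "L \<subseteq> carrier M" using submoduleE(1)[OF L] .
  have sub: "set (take i ys) \<union> L \<subseteq> carrier M" for i
    using Y(2) ys(1) set_take_subset[of i ys] Lc by blast
  have D: "submodule (D i) R M" for i unfolding D_def using submodule_lspan[OF sub] .
  show ?thesis
  proof (rule card_irredundant_le_chain[of "card Y" D X])
    fix i x y assume i: "i < card Y" and xy: "x \<in> D (Suc i)" "y \<in> D (Suc i)"
    have s: "ys ! i \<in> carrier M" using i ys Y(2) nth_mem by (metis subsetD)
    have Dc: "insert (ys ! i) (D i) \<subseteq> carrier M" using s submoduleE(1)[OF D] by auto
    have "D (Suc i) = lspan (insert (ys ! i) (set (take i ys) \<union> L))"
      unfolding D_def using i ys(2) by (simp add: take_Suc_conv_app_nth)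
    also have "\<dots> \<subseteq> lspan (insert (ys ! i) (D i))"
      by (rule lspan_mono) (auto simp: D_def intro: lspan_base)
    finally have "x \<in> lspan (insert (ys ! i) (D i))" "y \<in> lspan (insert (ys ! i) (D i))"
      using xy by auto
    then show "x \<in> lspan (insert y (D i)) \<or> y \<in> lspan (insert x (D i))"
      by (rule cyclic_extension_comparable[OF V D s])
  qed (use D X ys lspan_of_submodule[OF L] in \<open>auto simp: D_def\<close>)
qed

text \<open>The coefficients of \<open>w\<close> have a greatest common divisor \<open>d\<close>, which is one of them. Dividing
by it leaves the coefficient \<open>\<one>\<close> at some generator \<open>c\<close>.\<close>
lemma lspan_common_factor:
  assumes V: "valuation_ring R" and C: "finite C" "C \<noteq> {}" "C \<subseteq> carrier M" and w: "w \<in> lspan C"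
  shows "\<exists>d\<in>carrier R. \<exists>c\<in>C. \<exists>v\<in>lspan (C - {c}). w = d \<odot>\<^bsub>M\<^esub> (c \<oplus>\<^bsub>M\<^esub> v)"
  using C w
proof (induction C arbitrary: w rule: finite_ne_induct)
  case (singleton c)
  then obtain d where "d \<in> carrier R" "w = d \<odot>\<^bsub>M\<^esub> c" using lspan_singletonE by blast
  then show ?case using singleton by (auto simp: lspan_empty intro!: bexI[of _ d])
next
  case (insert b C)
  have cl: "b \<in> carrier M" "C \<subseteq> carrier M" using insert.prems by auto
  obtain r w' where w: "r \<in> carrier R" "w' \<in> lspan C" "w = r \<odot>\<^bsub>M\<^esub> b \<oplus>\<^bsub>M\<^esub> w'"
    using lspan_insertE[OF cl] insert.prems by blast
  obtain d c v where w': "d \<in> carrier R" "c \<in> C" "v \<in> lspan (C - {c})" "w' = d \<odot>\<^bsub>M\<^esub> (c \<oplus>\<^bsub>M\<^esub> v)"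
    using insert.IH[OF cl(2) w(2)] by blast
  have Cc: "C - {c} \<subseteq> carrier M" using cl by auto
  have cv: "c \<in> carrier M" "v \<in> carrier M"
    using w' cl lspan_subset_carrier[OF Cc] by auto
  from valuation_ring_divides[OF V w(1) w'(1)] show ?case
  proof (elim disjE bexE)
    fix e assume e: "e \<in> carrier R" "r = d \<otimes> e"
    let ?S = "insert b C - {c}"
    have Sc: "?S \<subseteq> carrier M" using cl by auto
    note S = submoduleE[OF submodule_lspan[OF Sc]]
    have "w = d \<odot>\<^bsub>M\<^esub> (c \<oplus>\<^bsub>M\<^esub> (v \<oplus>\<^bsub>M\<^esub> e \<odot>\<^bsub>M\<^esub> b))"
      using w w' e cl cv by (simp add: smult_r_distr smult_assoc1 M.a_ac)
    moreover have "v \<in> lspan ?S" using w'(3) lspan_mono[of "C - {c}" ?S] by blast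
    moreover have "e \<odot>\<^bsub>M\<^esub> b \<in> lspan ?S"
      using insert.hyps w'(2) e by (intro S(4) lspan_base) auto
    ultimately show ?thesis using w' S(5) by blast
  next
    fix e assume e: "e \<in> carrier R" "d = r \<otimes> e"
    note S = submoduleE[OF submodule_lspan[OF cl(2)]]
    have "w = r \<odot>\<^bsub>M\<^esub> (b \<oplus>\<^bsub>M\<^esub> e \<odot>\<^bsub>M\<^esub> (c \<oplus>\<^bsub>M\<^esub> v))"
      using w w' e cl cv by (simp add: smult_r_distr smult_assoc1 M.a_ac)
    moreover have "v \<in> lspan C" using w'(3) lspan_mono[of "C - {c}" C] by blast
    then have "e \<odot>\<^bsub>M\<^esub> (c \<oplus>\<^bsub>M\<^esub> v) \<in> lspan C" using e lspan_base[OF w'(2)] by (intro S(4) S(5)) auto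
    moreover have "insert b C - {b} = C" using insert.hyps by auto
    ultimately show ?thesis using w(1) by auto
  qed
qed

section \<open>Relatively divisible submodules\<close>

text \<open>For a submodule \<open>N\<close> this is \<open>N \<inter> r M = r N\<close> for all scalars \<open>r\<close>, also known as RD-purity.\<close>
definition relatively_divisible :: "'c set \<Rightarrow> bool" where
  "relatively_divisible N \<longleftrightarrow>
     (\<forall>r\<in>carrier R. \<forall>w\<in>carrier M. r \<odot>\<^bsub>M\<^esub> w \<in> N \<longrightarrow> (\<exists>y\<in>N. r \<odot>\<^bsub>M\<^esub> w = r \<odot>\<^bsub>M\<^esub> y))"

text \<open>The coefficient \<open>s\<close> of \<open>c\<close> in \<open>y\<close> is not a unit: otherwise \<open>c\<close> would lie in the span of \<open>B\<close>
modulo \<open>N\<close>, and fewer than \<open>card X\<close> elements would generate \<open>X\<close> modulo \<open>N\<close>. As the ring is local,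
\<open>\<one> - s\<close> is a unit, so \<open>c\<close> can be recovered from \<open>c + v - y\<close> and the other generators.\<close>
lemma exchange_step:
  assumes V: "valuation_ring R" and N: "submodule N R M"
    and L: "submodule L R M" "L \<subseteq> N"
    and X: "finite X" "irredundant N X"
    and B: "finite B" "B \<subseteq> carrier M" and c: "c \<in> carrier M" "v \<in> lspan B"
    and y: "y \<in> N" "y \<in> lspan (insert c B \<union> L)"
    and span: "X \<subseteq> lspan (insert c B \<union> L)" and card: "card B < card X"
  shows "c \<in> lspan (insert (c \<oplus>\<^bsub>M\<^esub> v \<oplus>\<^bsub>M\<^esub> \<ominus>\<^bsub>M\<^esub> y) B \<union> L)"
proof -
  let ?x = "c \<oplus>\<^bsub>M\<^esub> v \<oplus>\<^bsub>M\<^esub> \<ominus>\<^bsub>M\<^esub> y"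
  let ?S = "insert ?x B \<union> L"
  have Nc: "N \<subseteq> carrier M" and Lc: "L \<subseteq> carrier M" using submoduleE(1) N L by blast+
  have BLc: "B \<union> L \<subseteq> carrier M" and BNc: "B \<union> N \<subseteq> carrier M" using B Lc Nc by auto
  have cl: "v \<in> carrier M" "y \<in> carrier M" using c y Nc lspan_subset_carrier[OF B(2)] by auto
  then have Sc: "?S \<subseteq> carrier M" using c BLc by auto
  note S = submodule_lspan[OF Sc] and T = submodule_lspan[OF BNc]
  obtain s y' where s: "s \<in> carrier R" "y' \<in> lspan (B \<union> L)" "y = s \<odot>\<^bsub>M\<^esub> c \<oplus>\<^bsub>M\<^esub> y'"
    using lspan_insertE[OF c(1) BLc, of y] y(2) by auto
  have y'c: "y' \<in> carrier M" using s(2) lspan_subset_carrier[OF BLc] by auto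
  have "s \<notin> Units R"
  proof
    assume u: "s \<in> Units R"
    have "y' \<in> lspan (B \<union> N)" using s(2) lspan_mono[of "B \<union> L" "B \<union> N"] L(2) by blast
    moreover have "y \<in> lspan (B \<union> N)" using y(1) by (intro lspan_base) simp
    ultimately have "s \<odot>\<^bsub>M\<^esub> c \<in> lspan (B \<union> N)"
      using submodule_add_cancel[OF T, of "s \<odot>\<^bsub>M\<^esub> c" y'] s c by auto
    then have "inv s \<odot>\<^bsub>M\<^esub> (s \<odot>\<^bsub>M\<^esub> c) \<in> lspan (B \<union> N)" using u submoduleE(4)[OF T] by auto
    then have "c \<in> lspan (B \<union> N)" using u s c by (simp add: smult_assoc1[symmetric])
    then have "insert c B \<union> L \<subseteq> lspan (B \<union> N)" using L(2) by (auto intro: lspan_base)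
    then have "lspan (insert c B \<union> L) \<subseteq> lspan (B \<union> N)" by (rule lspan_le[OF BNc])
    then have "card X \<le> card B"
      using span by (intro card_irredundant_le_generators[OF V N B X]) auto
    then show False using card by simp
  qed
  then have u: "\<one> \<ominus> s \<in> Units R" by (rule valuation_ring_local[OF V s(1)])
  let ?t = "inv (\<one> \<ominus> s)"
  have in_S: "v \<in> lspan ?S" "y' \<in> lspan ?S" "?x \<in> lspan ?S"
    using c(2) s(2) lspan_mono[of B ?S] lspan_mono[of "B \<union> L" ?S] lspan_base[of ?x ?S] by auto
  have "((\<one> \<ominus> s) \<odot>\<^bsub>M\<^esub> c) \<oplus>\<^bsub>M\<^esub> v = ?x \<oplus>\<^bsub>M\<^esub> y'"
    using s c cl y'c
    by (simp add: R.minus_eq smult_l_distr smult_l_minus M.minus_add M.a_ac M.r_neg M.r_neg1 M.r_neg2)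
  then have "((\<one> \<ominus> s) \<odot>\<^bsub>M\<^esub> c) \<oplus>\<^bsub>M\<^esub> v \<in> lspan ?S" using in_S submoduleE(5)[OF S] by simp
  then have "(\<one> \<ominus> s) \<odot>\<^bsub>M\<^esub> c \<in> lspan ?S"
    using submodule_add_cancel[OF S] in_S s c by simp
  then have "?t \<odot>\<^bsub>M\<^esub> ((\<one> \<ominus> s) \<odot>\<^bsub>M\<^esub> c) \<in> lspan ?S" using u submoduleE(4)[OF S] by auto
  then show ?thesis using u s c by (simp add: smult_assoc1[symmetric])
qed

text \<open>If \<open>L\<close> is zero, this says that a nonzero relatively divisible submodule \<open>N\<close> cannot be
contained in a submodule with as many generators as its image modulo \<open>N\<close> requires. Given \<open>z \<in> N\<close>,
the proof keeps a set \<open>B \<union> C\<close> of generators and a scalar \<open>p\<close> such that \<open>p\<close> annihilates \<open>B\<close> and \<open>z\<close>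
is \<open>p\<close> times a combination of \<open>C\<close>, all modulo \<open>L\<close>. Such a combination is \<open>d (c + v)\<close> with \<open>c \<in> C\<close>
and \<open>v\<close> in the span of the rest of \<open>C\<close>. Relative divisibility gives \<open>y \<in> N\<close> with
\<open>p d (c + v) = p d y\<close>, so that \<open>p d\<close> annihilates \<open>c + v - y\<close>. This element is exchanged for \<open>c\<close>
and moves from \<open>C\<close> to \<open>B\<close>; rewriting \<open>y\<close> in the new generators shows that \<open>z\<close> is \<open>p d\<close> times a
combination of the smaller \<open>C\<close>. When \<open>C\<close> is empty, \<open>z\<close> lies in \<open>L\<close>.\<close>
lemma relatively_divisible_not_in_span:
  assumes V: "valuation_ring R" and N: "submodule N R M" "relatively_divisible N"
    and L: "submodule L R M" "L \<subseteq> N"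
    and X: "finite X" "irredundant N X" and NX: "N \<subseteq> lspan (X \<union> L)"
  shows "N \<subseteq> L"
proof
  fix z assume z: "z \<in> N"
  have Nc: "N \<subseteq> carrier M" and Lc: "L \<subseteq> carrier M" using submoduleE(1) N L by blast+
  have Xc: "X \<subseteq> carrier M" using X by (simp add: irredundant_def)
  have zc: "z \<in> carrier M" using z Nc by auto
  have main: "z \<in> L"
    if "finite B" "finite C" "B \<subseteq> carrier M" "C \<subseteq> carrier M" "X \<subseteq> lspan (B \<union> C \<union> L)"
      "card B + card C \<le> card X" "p \<in> carrier R" "\<And>b. b \<in> B \<Longrightarrow> p \<odot>\<^bsub>M\<^esub> b \<in> L"
      "w \<in> lspan C" "l \<in> L" "z = p \<odot>\<^bsub>M\<^esub> w \<oplus>\<^bsub>M\<^esub> l" for B C p w l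
    using that
  proof (induction "card C" arbitrary: B C p w l)
    case 0
    then have "w = \<zero>\<^bsub>M\<^esub>" by (simp add: lspan_empty)
    then show ?case using 0 Lc by auto
  next
    case (Suc m)
    have "C \<noteq> {}" using Suc.hyps by auto
    then obtain d c v where w: "d \<in> carrier R" "c \<in> C" "v \<in> lspan (C - {c})" "w = d \<odot>\<^bsub>M\<^esub> (c \<oplus>\<^bsub>M\<^esub> v)"
      using lspan_common_factor[OF V] Suc.prems by metis
    have Cc: "C - {c} \<subseteq> carrier M" using Suc.prems by auto
    have vc: "c \<in> carrier M" "v \<in> carrier M" "l \<in> carrier M"
      using w Suc.prems lspan_subset_carrier[OF Cc] Lc by auto
    let ?q = "p \<otimes> d" and ?B = "B \<union> (C - {c})"
    have q: "?q \<in> carrier R" using w Suc.prems by simp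
    have zq: "z = ?q \<odot>\<^bsub>M\<^esub> (c \<oplus>\<^bsub>M\<^esub> v) \<oplus>\<^bsub>M\<^esub> l"
      using w vc Suc.prems by (simp add: smult_assoc1)
    then have "?q \<odot>\<^bsub>M\<^esub> (c \<oplus>\<^bsub>M\<^esub> v) \<in> N"
      using submodule_add_cancel[OF N(1)] z L(2) Suc.prems(10) q vc by auto
    then obtain y where y: "y \<in> N" "?q \<odot>\<^bsub>M\<^esub> (c \<oplus>\<^bsub>M\<^esub> v) = ?q \<odot>\<^bsub>M\<^esub> y"
      using N(2) q vc unfolding relatively_divisible_def by blast
    have yc: "y \<in> carrier M" using y Nc by auto
    let ?x = "c \<oplus>\<^bsub>M\<^esub> v \<oplus>\<^bsub>M\<^esub> \<ominus>\<^bsub>M\<^esub> y"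
    have qx: "?q \<odot>\<^bsub>M\<^esub> ?x = \<zero>\<^bsub>M\<^esub>"
    proof -
      have "?q \<odot>\<^bsub>M\<^esub> ?x = ?q \<odot>\<^bsub>M\<^esub> (c \<oplus>\<^bsub>M\<^esub> v) \<oplus>\<^bsub>M\<^esub> ?q \<odot>\<^bsub>M\<^esub> (\<ominus>\<^bsub>M\<^esub> y)"
        using smult_r_distr[OF q, of "c \<oplus>\<^bsub>M\<^esub> v"] vc yc by simp
      also have "\<dots> = ?q \<odot>\<^bsub>M\<^esub> (y \<oplus>\<^bsub>M\<^esub> \<ominus>\<^bsub>M\<^esub> y)"
        unfolding y(2) using smult_r_distr[OF q yc, of "\<ominus>\<^bsub>M\<^esub> y"] yc by simp
      finally show ?thesis using q yc by (simp add: M.r_neg)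
    qed
    have xc: "?x \<in> carrier M" using vc yc by simp
    have eq: "insert c ?B \<union> L = B \<union> C \<union> L" using w(2) by auto
    have eq': "insert ?x ?B \<union> L = insert ?x B \<union> (C - {c}) \<union> L" by auto
    have BCLc: "B \<union> C \<union> L \<subseteq> carrier M" using Suc.prems Lc by auto
    have "X \<union> L \<subseteq> lspan (B \<union> C \<union> L)" using Suc.prems(5) by (auto intro: lspan_base)
    then have "lspan (X \<union> L) \<subseteq> lspan (B \<union> C \<union> L)" by (rule lspan_le[OF BCLc])
    then have yBCL: "y \<in> lspan (B \<union> C \<union> L)" using y(1) NX by auto
    have Bc: "?B \<subseteq> carrier M" using Suc.prems by auto
    have cardC: "card (C - {c}) = m" "card C = Suc m" using Suc.hyps w(2) by auto
    have "card ?B < card X"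
      using card_Un_le[of B "C - {c}"] cardC Suc.prems(6) by simp
    moreover have "v \<in> lspan ?B" using w(3) lspan_mono[of "C - {c}" ?B] by auto
    ultimately have "c \<in> lspan (insert ?x ?B \<union> L)"
      using exchange_step[OF V N(1) L X _ Bc vc(1), of v y] y(1) yBCL Suc.prems eq by simp
    then have cS: "c \<in> lspan (insert ?x B \<union> (C - {c}) \<union> L)" unfolding eq' .
    let ?S = "insert ?x B \<union> (C - {c}) \<union> L"
    have Sc: "?S \<subseteq> carrier M" using xc Bc Lc by auto
    have "B \<union> C \<union> L \<subseteq> lspan ?S"
    proof
      fix u assume "u \<in> B \<union> C \<union> L"
      then have "u = c \<or> u \<in> ?S" by auto
      then show "u \<in> lspan ?S" using cS lspan_base[of u ?S] by auto
    qed
    then have le: "lspan (B \<union> C \<union> L) \<subseteq> lspan ?S" by (rule lspan_le[OF Sc])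
    have "?S = (insert ?x B \<union> L) \<union> (C - {c})" by auto
    then have "y \<in> lspan ((insert ?x B \<union> L) \<union> (C - {c}))" using yBCL le by auto
    moreover have BLc: "insert ?x B \<union> L \<subseteq> carrier M" using Sc by auto
    ultimately obtain a w' where y': "a \<in> lspan (insert ?x B \<union> L)" "w' \<in> lspan (C - {c})"
      "y = a \<oplus>\<^bsub>M\<^esub> w'" using lspan_UnE[OF BLc Cc] by metis
    have ac: "a \<in> carrier M" "w' \<in> carrier M"
      using y' lspan_subset_carrier[OF BLc] lspan_subset_carrier[OF Cc] by auto
    have kill: "?q \<odot>\<^bsub>M\<^esub> b \<in> L" if b: "b \<in> insert ?x B \<union> L" for b
    proof -
      have "?q \<odot>\<^bsub>M\<^esub> b = d \<odot>\<^bsub>M\<^esub> (p \<odot>\<^bsub>M\<^esub> b)" if "b \<in> B"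
        using that Suc.prems(3,7) w(1) smult_assoc1[of d p b] R.m_comm[of p d] by auto
      then show ?thesis
        using b qx submodule_zero[OF L(1)] submoduleE(4)[OF L(1)] Suc.prems(8) w(1) q by auto
    qed
    have qa: "?q \<odot>\<^bsub>M\<^esub> a \<in> L" using smult_lspan_mem[OF L(1) q BLc kill y'(1)] .
    have "z = ?q \<odot>\<^bsub>M\<^esub> w' \<oplus>\<^bsub>M\<^esub> (?q \<odot>\<^bsub>M\<^esub> a \<oplus>\<^bsub>M\<^esub> l)"
      unfolding zq y(2) y'(3) using q ac vc by (simp add: smult_r_distr M.a_ac)
    moreover have "card (insert ?x B) + card (C - {c}) \<le> card X"
      using cardC Suc.prems(1,6)
      by (simp add: card_insert_if)
    moreover have "X \<subseteq> lspan ?S" using Suc.prems(5) le by auto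
    moreover have "?q \<odot>\<^bsub>M\<^esub> a \<oplus>\<^bsub>M\<^esub> l \<in> L" using qa Suc.prems(10) submoduleE(5)[OF L(1)] by auto
    ultimately show ?case
      using kill cardC(1) y'(2) q xc Suc.prems(1-4)
      by (intro Suc.hyps(1)[of "C - {c}" "insert ?x B" ?q w' "?q \<odot>\<^bsub>M\<^esub> a \<oplus>\<^bsub>M\<^esub> l"]) auto
  qed
  have "z \<in> lspan (X \<union> L)" using z NX by auto
  then obtain w l where w: "w \<in> lspan X" "l \<in> L" "z = w \<oplus>\<^bsub>M\<^esub> l"
    using lspan_UnE[OF Xc Lc] lspan_of_submodule[OF L(1)] by metis
  have wc: "w \<in> carrier M" using w lspan_subset_carrier[OF Xc] by auto
  show "z \<in> L"
    by (rule main[of "{}" X "\<one>" w l])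
      (use X Xc w wc lspan_base[of _ "X \<union> L"] in auto)
qed

text \<open>One step down a chain of relatively divisible submodules enlarges an irredundant set by one
element: any \<open>x \<in> N\<close> outside the span of \<open>X\<close> modulo \<open>L\<close> can be added, because irredundance of the
old elements holds even modulo \<open>N\<close>.\<close>
lemma irredundant_extend:
  assumes V: "valuation_ring R" and N: "submodule N R M" "relatively_divisible N"
    and L: "submodule L R M" "L \<subset> N"
    and X: "finite X" "irredundant N X"
  obtains x where "x \<notin> X" "irredundant L (insert x X)"
proof -
  have Nc: "N \<subseteq> carrier M" using submoduleE(1)[OF N(1)] .
  have Xc: "X \<subseteq> carrier M" using X by (simp add: irredundant_def)
  have "\<not> N \<subseteq> lspan (X \<union> L)"
    using relatively_divisible_not_in_span[OF V N L(1) _ X] L(2) by auto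
  then obtain x where x: "x \<in> N" "x \<notin> lspan (X \<union> L)" by blast
  have xX: "x \<notin> X" using x(2) lspan_base[of x "X \<union> L"] by auto
  have "u \<notin> lspan ((insert x X - {u}) \<union> L)" if u: "u \<in> insert x X" for u
  proof (cases "u = x")
    case True
    then show ?thesis using x(2) xX by simp
  next
    case False
    then have "u \<notin> lspan ((X - {u}) \<union> N)" using u X by (simp add: irredundant_def)
    moreover have "lspan ((insert x X - {u}) \<union> L) \<subseteq> lspan ((X - {u}) \<union> N)"
      by (rule lspan_mono) (use x L in auto)
    ultimately show ?thesis by blast
  qed
  then have "irredundant L (insert x X)" unfolding irredundant_def using Xc x(1) Nc by auto
  then show thesis using that xX by blast
qed

end

section \<open>Purity implies relative divisibility\<close>

text \<open>An instance of the universal property of the tensor product: an element whose pure tensor is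
zero is mapped to zero by every balanced map.\<close>
lemma balanced_map_vanishes:
  assumes M: "module R M" and X: "module R X" and G: "abelian_group G"
    and cl: "\<And>a x. a \<in> carrier M \<Longrightarrow> x \<in> carrier X \<Longrightarrow> f a x \<in> carrier G"
    and left: "\<And>a b x. a \<in> carrier M \<Longrightarrow> b \<in> carrier M \<Longrightarrow> x \<in> carrier X \<Longrightarrow>
      f (a \<oplus>\<^bsub>M\<^esub> b) x = f a x \<oplus>\<^bsub>G\<^esub> f b x"
    and right: "\<And>a x y. a \<in> carrier M \<Longrightarrow> x \<in> carrier X \<Longrightarrow> y \<in> carrier X \<Longrightarrow>
      f a (x \<oplus>\<^bsub>X\<^esub> y) = f a x \<oplus>\<^bsub>G\<^esub> f a y"
    and balanced: "\<And>r a x. r \<in> carrier R \<Longrightarrow> a \<in> carrier M \<Longrightarrow> x \<in> carrier X \<Longrightarrow>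
      f (r \<odot>\<^bsub>M\<^esub> a) x = f a (r \<odot>\<^bsub>X\<^esub> x)"
    and ax: "a \<in> carrier M" "x \<in> carrier X" "frag_of (a, x) \<in> tensor_kernel R M X"
  shows "f a x = \<zero>\<^bsub>G\<^esub>"
proof -
  interpret M: module R M by fact
  interpret X: module R X by fact
  interpret G: abelian_group G by fact
  let ?S = "carrier M \<times> carrier X" and ?F = "free_Abelian_group (carrier M \<times> carrier X)"
  have "(\<lambda>(a, x). f a x) ` ?S \<subseteq> carrier (add_monoid G)" using cl by auto
  then obtain h where h: "h \<in> hom ?F (add_monoid G)" "\<And>p. p \<in> ?S \<Longrightarrow> h (frag_of p) = (case p of (a, x) \<Rightarrow> f a x)"
    using comm_group.free_Abelian_group_universal[OF G.a_comm_group] by metis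
  have hf: "h (frag_of (a, x)) = f a x" if "a \<in> carrier M" "x \<in> carrier X" for a x
    using h(2)[of "(a, x)"] that by simp
  interpret h: group_hom ?F "add_monoid G" h
    using h(1) by (simp add: group_hom_def group_hom_axioms_def G.a_group)
  have hadd: "h (c + d) = h c \<oplus>\<^bsub>G\<^esub> h d" if "Poly_Mapping.keys c \<subseteq> ?S" "Poly_Mapping.keys d \<subseteq> ?S" for c d
    using h.hom_mult[of c d] that by simp
  have hcl: "h c \<in> carrier G" if "Poly_Mapping.keys c \<subseteq> ?S" for c
    using h.hom_closed[of c] that by simp
  have hdiff: "h (c - d) = \<zero>\<^bsub>G\<^esub>" if "Poly_Mapping.keys c \<subseteq> ?S" "Poly_Mapping.keys d \<subseteq> ?S" "h c = h d" for c d
  proof -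
    have "h (c - d) \<oplus>\<^bsub>G\<^esub> h d = h d"
      using hadd[of "c - d" d] keys_diff_subset[OF that(1,2)] that by simp
    then show ?thesis using hcl[OF that(2)] hcl[OF keys_diff_subset[OF that(1,2)]] by (metis G.add.r_cancel_one)
  qed
  have "h c = \<zero>\<^bsub>G\<^esub>" if "c \<in> tensor_kernel R M X" for c
  proof -
    have "h c = \<zero>\<^bsub>G\<^esub> \<and> Poly_Mapping.keys c \<subseteq> ?S"
      using M X that
    proof (induction rule: tensor_kernel_induct)
      case zero
      show ?case using h.hom_one by simp
    next
      case (rel c)
      then show ?case
      proof (cases rule: tensor_relsE)
        case (1 a b x)
        have "h (frag_of (a \<oplus>\<^bsub>M\<^esub> b, x)) = h (frag_of (a, x) + frag_of (b, x))"
          using 1 hadd[of "frag_of (a, x)" "frag_of (b, x)"] by (simp add: hf left)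
        then have "h (frag_of (a \<oplus>\<^bsub>M\<^esub> b, x) - (frag_of (a, x) + frag_of (b, x))) = \<zero>\<^bsub>G\<^esub>"
          using 1 by (intro hdiff keys_add_subset) auto
        then show ?thesis using 1(4) tensor_rels_carrier[OF M X rel] by (simp add: diff_diff_eq)
      next
        case (2 a x y)
        have "h (frag_of (a, x \<oplus>\<^bsub>X\<^esub> y)) = h (frag_of (a, x) + frag_of (a, y))"
          using 2 hadd[of "frag_of (a, x)" "frag_of (a, y)"] by (simp add: hf right)
        then have "h (frag_of (a, x \<oplus>\<^bsub>X\<^esub> y) - (frag_of (a, x) + frag_of (a, y))) = \<zero>\<^bsub>G\<^esub>"
          using 2 by (intro hdiff keys_add_subset) auto
        then show ?thesis using 2(4) tensor_rels_carrier[OF M X rel] by (simp add: diff_diff_eq)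
      next
        case (3 r a x)
        have "h (frag_of (r \<odot>\<^bsub>M\<^esub> a, x)) = h (frag_of (a, r \<odot>\<^bsub>X\<^esub> x))"
          using 3 by (simp add: hf balanced)
        then show ?thesis using 3 tensor_rels_carrier[OF M X rel] by (auto intro!: hdiff)
      qed
    next
      case (minus c)
      then show ?case using hdiff[of 0 c] h.hom_one by simp
    next
      case (add a b)
      then show ?case using hadd[of a b] by (simp add: keys_add_subset)
    qed
    then show ?thesis ..
  qed
  then show ?thesis using ax hf by metis
qed

context module begin

lemma coset_eq_iff:
  assumes "submodule N R M" "a \<in> carrier M" "b \<in> carrier M"
  shows "N +>\<^bsub>M\<^esub> a = N +>\<^bsub>M\<^esub> b \<longleftrightarrow> (\<exists>n\<in>N. a = n \<oplus>\<^bsub>M\<^esub> b)"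
proof
  assume eq: "N +>\<^bsub>M\<^esub> a = N +>\<^bsub>M\<^esub> b"
  have "\<zero>\<^bsub>M\<^esub> \<oplus>\<^bsub>M\<^esub> a \<in> N +>\<^bsub>M\<^esub> a"
    unfolding a_r_coset_def' using submodule_zero[OF assms(1)] by blast
  then have "a \<in> N +>\<^bsub>M\<^esub> b" using assms(2) eq by simp
  then show "\<exists>n\<in>N. a = n \<oplus>\<^bsub>M\<^esub> b" unfolding a_r_coset_def' by auto
next
  assume "\<exists>n\<in>N. a = n \<oplus>\<^bsub>M\<^esub> b"
  then have "a \<in> N +>\<^bsub>M\<^esub> b" unfolding a_r_coset_def' by auto
  from M.a_repr_independence[OF this assms(3) submodule.axioms(1)[OF assms(1)]]
  show "N +>\<^bsub>M\<^esub> a = N +>\<^bsub>M\<^esub> b" by (rule sym)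
qed

lemma submodule_restrict_iff:
  assumes "submodule K R M"
  shows "submodule H R (M\<lparr>carrier := K\<rparr>) \<longleftrightarrow> submodule H R M \<and> H \<subseteq> K"
proof -
  interpret K: module R "M\<lparr>carrier := K\<rparr>"
    using submodule.submodule_is_module[OF assms module_axioms] .
  note Kc = submoduleE(1)[OF assms]
  show ?thesis
  proof
    assume H: "submodule H R (M\<lparr>carrier := K\<rparr>)"
    show "submodule H R M \<and> H \<subseteq> K"
      using K.submoduleE[OF H] K.submodule_zero[OF H] Kc by (auto intro!: submodule_of_scalars)
  next
    assume H: "submodule H R M \<and> H \<subseteq> K"
    then show "submodule H R (M\<lparr>carrier := K\<rparr>)"
      using submoduleE[of H] submodule_zero[of H] by (auto intro!: K.submodule_of_scalars)
  qed
qed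

lemma hull_submodule_restrict:
  assumes K: "submodule K R M" and S: "S \<subseteq> K"
  shows "(\<lambda>H. submodule H R (M\<lparr>carrier := K\<rparr>)) hull S = lspan S"
proof
  have Sc: "S \<subseteq> carrier M" using S submoduleE(1)[OF K] by auto
  have "submodule (lspan S) R (M\<lparr>carrier := K\<rparr>)"
    using submodule_restrict_iff[OF K] submodule_lspan[OF Sc] lspan_minimal[OF S K] by blast
  then show "(\<lambda>H. submodule H R (M\<lparr>carrier := K\<rparr>)) hull S \<subseteq> lspan S"
    by (intro hull_minimal lspan_superset)
  show "lspan S \<subseteq> (\<lambda>H. submodule H R (M\<lparr>carrier := K\<rparr>)) hull S"
    unfolding lspan_def by (rule hull_antimono) (simp add: submodule_restrict_iff[OF K])
qed

text \<open>Purity is tested against \<open>R / r R\<close>. In \<open>M \<otimes> R / r R\<close> the tensor of \<open>r w\<close> and the class of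
\<open>\<one>\<close> equals that of \<open>w\<close> and the class of \<open>r\<close>, so it is zero. By purity it is already zero in
\<open>N \<otimes> R / r R\<close>. The balanced map that sends \<open>a\<close> and the class of \<open>s\<close> to the class of \<open>s a\<close> in
\<open>N / r N\<close> takes it to the class of \<open>r w\<close>, which is therefore zero.\<close>
lemma pure_submodule_relatively_divisible:
  assumes pure: "pure_submodule R M N"
  shows "relatively_divisible N"
  unfolding relatively_divisible_def
proof (intro ballI impI)
  fix r w assume r: "r \<in> carrier R" and w: "w \<in> carrier M" and rw: "r \<odot>\<^bsub>M\<^esub> w \<in> N"
  have M: "module R M" by (rule module_axioms)
  have cring: "cring R" by (rule R.is_cring)
  have N: "submodule N R M" using pure by (simp add: pure_submodule_def)
  let ?N = "M\<lparr>carrier := N\<rparr>"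
  interpret N: module R ?N using submodule.submodule_is_module[OF N M] .
  let ?P = "regular_module R" and ?I = "(\<lambda>s. r \<otimes> s) ` carrier R"
  interpret P: module R ?P by (rule module_regular_module[OF cring])
  have I: "submodule ?I R ?P" by (rule submodule_principal[OF cring r])
  let ?X = "quotient_module ?P ?I" and ?p = "\<lambda>s. ?I +>\<^bsub>?P\<^esub> s"
  note Xq = quotient_module_is_module[OF P.module_axioms I]
  interpret X: module R ?X by (rule Xq(1))
  let ?J = "(\<lambda>y. r \<odot>\<^bsub>M\<^esub> y) ` N"
  have J: "submodule ?J R ?N"
    using N.submodule_smult_image[OF N.carrier_is_submodule r] by simp
  let ?G = "quotient_module ?N ?J" and ?g = "\<lambda>a. ?J +>\<^bsub>?N\<^esub> a"
  note Gq = quotient_module_is_module[OF N.module_axioms J]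
  interpret G: module R ?G by (rule Gq(1))
  have regular: "carrier ?P = carrier R" "s \<oplus>\<^bsub>?P\<^esub> t = s \<oplus> t" "s \<odot>\<^bsub>?P\<^esub> t = s \<otimes> t" for s t
    by (simp_all add: regular_module_def)
  have p: "?p s \<in> carrier ?X" "?p (s \<oplus> t) = ?p s \<oplus>\<^bsub>?X\<^esub> ?p t" "?p (s \<otimes> t) = s \<odot>\<^bsub>?X\<^esub> ?p t"
    if "s \<in> carrier R" "t \<in> carrier R" for s t
    using Xq(2) that unfolding mod_hom_def regular by auto
  have g: "?g a \<in> carrier ?G" "?g (a \<oplus>\<^bsub>M\<^esub> b) = ?g a \<oplus>\<^bsub>?G\<^esub> ?g b" if "a \<in> N" "b \<in> N" for a b
    using Gq(2) that unfolding mod_hom_def by auto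
  \<comment> \<open>The balanced map is defined on representatives of the cosets in \<open>R / r R\<close>.\<close>
  define rep where "rep C = (SOME s. s \<in> carrier R \<and> ?p s = C)" for C
  have rep: "rep C \<in> carrier R" "?p (rep C) = C" if "C \<in> carrier ?X" for C
  proof -
    have "\<exists>s. s \<in> carrier R \<and> ?p s = C" using that Xq(3) by (auto simp: regular)
    from someI_ex[OF this] show "rep C \<in> carrier R" "?p (rep C) = C" by (simp_all add: rep_def)
  qed
  have well_defined: "?g (s \<odot>\<^bsub>M\<^esub> a) = ?g (t \<odot>\<^bsub>M\<^esub> a)"
    if st: "s \<in> carrier R" "t \<in> carrier R" "?p s = ?p t" and a: "a \<in> N" for s t a
  proof -
    obtain q where q: "q \<in> carrier R" "s = r \<otimes> q \<oplus> t"
      using P.coset_eq_iff[OF I, of s t] st by (auto simp: regular)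
    have qa: "q \<odot>\<^bsub>M\<^esub> a \<in> N" using N.smult_closed[of q a] q a by simp
    have "s \<odot>\<^bsub>M\<^esub> a = r \<odot>\<^bsub>M\<^esub> (q \<odot>\<^bsub>M\<^esub> a) \<oplus>\<^bsub>M\<^esub> t \<odot>\<^bsub>M\<^esub> a"
      using q r st a N.smult_l_distr[of "r \<otimes> q" t a] N.smult_assoc1[of r q a] by simp
    then have "\<exists>n\<in>?J. s \<odot>\<^bsub>M\<^esub> a = n \<oplus>\<^bsub>?N\<^esub> t \<odot>\<^bsub>M\<^esub> a" using qa by auto
    moreover have "s \<odot>\<^bsub>M\<^esub> a \<in> carrier ?N" "t \<odot>\<^bsub>M\<^esub> a \<in> carrier ?N"
      using N.smult_closed[of s a] N.smult_closed[of t a] st a by simp_all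
    ultimately show ?thesis using N.coset_eq_iff[OF J] by blast
  qed
  define f where "f a C = ?g (rep C \<odot>\<^bsub>M\<^esub> a)" for a C
  have f: "f a (?p s) = ?g (s \<odot>\<^bsub>M\<^esub> a)" if "s \<in> carrier R" "a \<in> N" for a s
    unfolding f_def using well_defined[of "rep (?p s)" s a] rep[OF p(1)[OF that(1) that(1)]] that by simp
  have lift: "\<exists>s\<in>carrier R. C = ?p s" if "C \<in> carrier ?X" for C
    using rep[OF that] by metis
  have sN: "s \<odot>\<^bsub>M\<^esub> a \<in> N" if "s \<in> carrier R" "a \<in> N" for s a
    using N.smult_closed[of s a] that by simp
  have "f (r \<odot>\<^bsub>M\<^esub> w) (?p \<one>) = \<zero>\<^bsub>?G\<^esub>"
  proof (rule balanced_map_vanishes[OF N.module_axioms Xq(1) G.abelian_group_axioms])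
    show "f a C \<in> carrier ?G" if "a \<in> carrier ?N" "C \<in> carrier ?X" for a C
      using g(1)[of "rep C \<odot>\<^bsub>M\<^esub> a"] sN[of "rep C" a] rep[OF that(2)] that by (simp add: f_def)
    show "f (a \<oplus>\<^bsub>?N\<^esub> b) C = f a C \<oplus>\<^bsub>?G\<^esub> f b C"
      if "a \<in> carrier ?N" "b \<in> carrier ?N" "C \<in> carrier ?X" for a b C
      using that rep[OF that(3)] g(2)[OF sN sN] N.smult_r_distr[of "rep C" a b] by (simp add: f_def)
    show "f a (C \<oplus>\<^bsub>?X\<^esub> D) = f a C \<oplus>\<^bsub>?G\<^esub> f a D"
      if aN: "a \<in> carrier ?N" and CD: "C \<in> carrier ?X" "D \<in> carrier ?X" for a C D
    proof -
      obtain s t where st: "s \<in> carrier R" "t \<in> carrier R" "C = ?p s" "D = ?p t" using CD lift by metis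
      have a: "a \<in> N" using aN by simp
      show ?thesis
        unfolding st(3,4) p(2)[OF st(1,2), symmetric] f[OF st(1) a] f[OF st(2) a] f[OF R.a_closed[OF st(1,2)] a]
        using g(2)[OF sN[OF st(1) a] sN[OF st(2) a]] N.smult_l_distr[OF st(1,2), of a] a by simp
    qed
    show "f (q \<odot>\<^bsub>?N\<^esub> a) C = f a (q \<odot>\<^bsub>?X\<^esub> C)"
      if q: "q \<in> carrier R" and aN: "a \<in> carrier ?N" and C: "C \<in> carrier ?X" for q a C
    proof -
      obtain s where s: "s \<in> carrier R" "C = ?p s" using C lift by metis
      have a: "a \<in> N" using aN by simp
      have "(q \<otimes> s) \<odot>\<^bsub>M\<^esub> a = s \<odot>\<^bsub>M\<^esub> (q \<odot>\<^bsub>M\<^esub> a)"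
        using N.smult_assoc1[OF s(1) q, of a] a by (simp add: R.m_comm[OF q s(1)])
      then show ?thesis
        unfolding s(2) p(3)[OF q s(1), symmetric] f[OF R.m_closed[OF q s(1)] a]
        using f[OF s(1) sN[OF q a]] by simp
    qed
    show "r \<odot>\<^bsub>M\<^esub> w \<in> carrier ?N" using rw by simp
    show one: "?p \<one> \<in> carrier ?X" by (rule p(1)[OF R.one_closed R.one_closed])
    have "r \<odot>\<^bsub>?X\<^esub> ?p \<one> = ?p r" using p(3)[OF r R.one_closed] r by simp
    also have "\<dots> = ?p \<zero>"
    proof -
      have "\<exists>n\<in>?I. r = n \<oplus>\<^bsub>?P\<^esub> \<zero>"
        unfolding regular using r by (intro bexI[of _ "r \<otimes> \<one>"] imageI) simp_all
      then show ?thesis using P.coset_eq_iff[OF I, of r \<zero>] r unfolding regular by simp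
    qed
    also have "\<dots> = \<zero>\<^bsub>?X\<^esub>" using p(3)[OF R.zero_closed R.one_closed] X.smult_l_null[OF one] by simp
    finally have r1: "r \<odot>\<^bsub>?X\<^esub> ?p \<one> = \<zero>\<^bsub>?X\<^esub>" .
    let ?k = "tensor_kernel R M ?X"
    have "frag_of (w, \<zero>\<^bsub>?X\<^esub> \<oplus>\<^bsub>?X\<^esub> \<zero>\<^bsub>?X\<^esub>) - frag_of (w, \<zero>\<^bsub>?X\<^esub>) - frag_of (w, \<zero>\<^bsub>?X\<^esub>) \<in> ?k"
      using w by (intro tensor_kernel_rel tensor_relsI(2)) auto
    then have "- frag_of (w, \<zero>\<^bsub>?X\<^esub>) \<in> ?k" by simp
    from tensor_kernel_minus[OF M Xq(1) this] have "frag_of (w, \<zero>\<^bsub>?X\<^esub>) \<in> ?k" by simp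
    moreover have "frag_of (r \<odot>\<^bsub>M\<^esub> w, ?p \<one>) - frag_of (w, r \<odot>\<^bsub>?X\<^esub> ?p \<one>) \<in> ?k"
      using r w one by (intro tensor_kernel_rel tensor_relsI(3))
    ultimately have "frag_of (r \<odot>\<^bsub>M\<^esub> w, ?p \<one>) \<in> ?k"
      unfolding r1 using tensor_kernel_add by fastforce
    moreover have "Poly_Mapping.keys (frag_of (r \<odot>\<^bsub>M\<^esub> w, ?p \<one>)) \<subseteq> N \<times> carrier ?X"
      using rw one by simp
    moreover have "exact_after_tensor R M N ?X" by (rule pure_submoduleD[OF M pure Xq(1)])
    ultimately show "frag_of (r \<odot>\<^bsub>M\<^esub> w, ?p \<one>) \<in> tensor_kernel R ?N ?X"
      unfolding exact_after_tensor_iff[OF M N Xq(1)] by blast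
  qed
  moreover have "?g \<zero>\<^bsub>M\<^esub> = \<zero>\<^bsub>?G\<^esub>"
    using N.M.a_coset_add_zero[OF N.submoduleE(1)[OF J]] by (simp add: quotient_module_def)
  ultimately have "?g (r \<odot>\<^bsub>M\<^esub> w) = ?g \<zero>\<^bsub>M\<^esub>"
    using f[OF R.one_closed rw] r w by simp
  then obtain y where y: "y \<in> N" "r \<odot>\<^bsub>M\<^esub> w = r \<odot>\<^bsub>M\<^esub> y \<oplus>\<^bsub>M\<^esub> \<zero>\<^bsub>M\<^esub>"
    using N.coset_eq_iff[OF J, of "r \<odot>\<^bsub>M\<^esub> w" "\<zero>\<^bsub>M\<^esub>"] rw submodule_zero[OF N] by auto
  moreover have "y \<in> carrier M" using y(1) submoduleE(1)[OF N] by auto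
  ultimately show "\<exists>y\<in>N. r \<odot>\<^bsub>M\<^esub> w = r \<odot>\<^bsub>M\<^esub> y" using r by (intro bexI[of _ y]) simp_all
qed

end

section \<open>Uniserial factors\<close>

context module begin

text \<open>The images in \<open>M / N\<close> of the submodules generated by \<open>N\<close> and one of the two elements are
comparable.\<close>
lemma uniserial_quotient_comparable:
  assumes N: "submodule N R M" and U: "uniserial R (quotient_module M N)"
    and xy: "x \<in> carrier M" "y \<in> carrier M"
  shows "x \<in> lspan (insert y N) \<or> y \<in> lspan (insert x N)"
proof -
  let ?Q = "quotient_module M N" and ?p = "\<lambda>a. N +>\<^bsub>M\<^esub> a"
  note Qq = quotient_module_is_module[OF module_axioms N]
  interpret Q: module R ?Q by (rule Qq(1))
  have Nc: "N \<subseteq> carrier M" using submoduleE(1)[OF N] .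
  have hom: "?p (a \<oplus>\<^bsub>M\<^esub> b) = ?p a \<oplus>\<^bsub>?Q\<^esub> ?p b" "?p (r \<odot>\<^bsub>M\<^esub> a) = r \<odot>\<^bsub>?Q\<^esub> ?p a"
    if "a \<in> carrier M" "b \<in> carrier M" "r \<in> carrier R" for a b r
    using Qq(2) that unfolding mod_hom_def by auto
  have image: "submodule (?p ` A) R ?Q" if A: "submodule A R M" for A
  proof (rule Q.submodule_of_scalars)
    note A' = submoduleE[OF A]
    show "?p ` A \<subseteq> carrier ?Q" using A'(1) Qq(3) by auto
    have "?p \<zero>\<^bsub>M\<^esub> = \<zero>\<^bsub>?Q\<^esub>"
      using hom(2)[of "\<zero>\<^bsub>M\<^esub>" "\<zero>\<^bsub>M\<^esub>" \<zero>] Q.smult_l_null[of "?p \<zero>\<^bsub>M\<^esub>"] Qq(3) by simp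
    then show "\<zero>\<^bsub>?Q\<^esub> \<in> ?p ` A" using submodule_zero[OF A] by (metis imageI)
    fix u v assume "u \<in> ?p ` A" "v \<in> ?p ` A"
    then obtain a b where ab: "a \<in> A" "b \<in> A" "u = ?p a" "v = ?p b" by blast
    then have "u \<oplus>\<^bsub>?Q\<^esub> v = ?p (a \<oplus>\<^bsub>M\<^esub> b)" using hom(1)[of a b \<one>] A'(1) by auto
    then show "u \<oplus>\<^bsub>?Q\<^esub> v \<in> ?p ` A" using A'(5)[OF ab(1,2)] by blast
  next
    note A' = submoduleE[OF A]
    fix r u assume r: "r \<in> carrier R" and "u \<in> ?p ` A"
    then obtain a where a: "a \<in> A" "u = ?p a" by blast
    then have "r \<odot>\<^bsub>?Q\<^esub> u = ?p (r \<odot>\<^bsub>M\<^esub> a)" using hom(2)[of a a r] A'(1) r by auto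
    then show "r \<odot>\<^bsub>?Q\<^esub> u \<in> ?p ` A" using A'(4)[OF r a(1)] by blast
  qed
  have sub: "insert u N \<subseteq> carrier M" if "u \<in> carrier M" for u using that Nc by auto
  have "u \<in> lspan (insert v N)"
    if uv: "u \<in> carrier M" "v \<in> carrier M" and le: "?p ` lspan (insert u N) \<subseteq> ?p ` lspan (insert v N)" for u v
  proof -
    note V = submodule_lspan[OF sub[OF uv(2)]]
    have "?p u \<in> ?p ` lspan (insert v N)" using le lspan_base[of u "insert u N"] by blast
    then obtain b where b: "b \<in> lspan (insert v N)" "?p u = ?p b" by blast
    then have "b \<in> carrier M" using submoduleE(1)[OF V] by auto
    then obtain n where "n \<in> N" "u = n \<oplus>\<^bsub>M\<^esub> b" using coset_eq_iff[OF N uv(1)] b(2) by auto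
    then show ?thesis using b(1) lspan_base[of n "insert v N"] submoduleE(5)[OF V] by simp
  qed
  moreover have "?p ` lspan (insert x N) \<subseteq> ?p ` lspan (insert y N) \<or>
      ?p ` lspan (insert y N) \<subseteq> ?p ` lspan (insert x N)"
    using U image submodule_lspan[OF sub] xy by (simp add: uniserial_def)
  ultimately show ?thesis using xy by blast
qed

lemma uniserial_factor_comparable:
  assumes K: "submodule K R M" and N: "submodule N R M" "N \<subseteq> K"
    and U: "uniserial R (quotient_module (M\<lparr>carrier := K\<rparr>) N)" and xy: "x \<in> K" "y \<in> K"
  shows "x \<in> lspan (insert y N) \<or> y \<in> lspan (insert x N)"
proof -
  interpret K: module R "M\<lparr>carrier := K\<rparr>"
    using submodule.submodule_is_module[OF K module_axioms] .
  have "K.lspan (insert u N) = lspan (insert u N)" if "u \<in> K" for u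
    unfolding K.lspan_def using hull_submodule_restrict[OF K, of "insert u N"] that N(2) by auto
  then show ?thesis
    using K.uniserial_quotient_comparable[of N x y] submodule_restrict_iff[OF K] N U xy by auto
qed

section \<open>Numbers of generators and the Malcev rank\<close>

lemma gen_submodule:
  assumes "submodule A R M"
  shows "gen R (M\<lparr>carrier := A\<rparr>) = Inf {enat (card S) | S. finite S \<and> S \<subseteq> A \<and> lspan S = A}"
  unfolding gen_def
  by (rule arg_cong[where f = Inf]) (use hull_submodule_restrict[OF assms] in auto)

lemma minimal_generators_irredundant:
  assumes S: "finite S" "S \<subseteq> carrier M"
    and minimal: "\<And>T. finite T \<Longrightarrow> T \<subseteq> S \<Longrightarrow> lspan T = lspan S \<Longrightarrow> card S \<le> card T"
  shows "irredundant {\<zero>\<^bsub>M\<^esub>} S"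
  unfolding irredundant_def
proof (intro conjI ballI notI S(2))
  fix x assume x: "x \<in> S" "x \<in> lspan (S - {x} \<union> {\<zero>\<^bsub>M\<^esub>})"
  have c: "S - {x} \<subseteq> carrier M" using S by auto
  have "S - {x} \<union> {\<zero>\<^bsub>M\<^esub>} \<subseteq> lspan (S - {x})"
    using submodule_zero[OF submodule_lspan[OF c]] lspan_superset[of "S - {x}"] by auto
  from lspan_le[OF c this] have "S \<subseteq> lspan (S - {x})" using x lspan_superset[of "S - {x}"] by auto
  from lspan_le[OF c this] have "lspan (S - {x}) = lspan S" using lspan_mono[of "S - {x}" S] by auto
  then have "card S \<le> card (S - {x})" using S by (intro minimal) auto
  then show False using card_Diff1_less[OF S(1) x(1)] by linarith
qed

lemma gen_le_chain_length:
  assumes D: "\<And>i. i \<le> k \<Longrightarrow> submodule (D i) R M" "D 0 = {\<zero>\<^bsub>M\<^esub>}" "D k = carrier M"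
    and step: "\<And>i x y. i < k \<Longrightarrow> x \<in> D (Suc i) \<Longrightarrow> y \<in> D (Suc i) \<Longrightarrow>
      x \<in> lspan (insert y (D i)) \<or> y \<in> lspan (insert x (D i))"
    and A: "submodule A R M" "gen R (M\<lparr>carrier := A\<rparr>) < \<infinity>"
  shows "gen R (M\<lparr>carrier := A\<rparr>) \<le> enat k"
proof -
  let ?gens = "\<lambda>S. finite S \<and> S \<subseteq> A \<and> lspan S = A"
  have "\<exists>S. ?gens S"
  proof (rule ccontr)
    assume "\<nexists>S. ?gens S"
    then have "{enat (card S) | S. ?gens S} = {}" by blast
    then have "gen R (M\<lparr>carrier := A\<rparr>) = \<infinity>"
      unfolding gen_submodule[OF A(1)] by (simp only: Inf_empty top_enat_def)
    then show False using A(2) by simp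
  qed
  then obtain S where S: "?gens S" "\<And>T. ?gens T \<Longrightarrow> card S \<le> card T"
    using ex_has_least_nat[of ?gens _ card] by metis
  have Sc: "S \<subseteq> carrier M" using S(1) submoduleE(1)[OF A(1)] by auto
  have "irredundant {\<zero>\<^bsub>M\<^esub>} S"
    by (rule minimal_generators_irredundant) (use S Sc in auto)
  then have "card S \<le> k"
    using S(1) Sc D(2,3) by (intro card_irredundant_le_chain[of k D S] D(1) step) auto
  moreover have "gen R (M\<lparr>carrier := A\<rparr>) \<le> enat (card S)"
    unfolding gen_submodule[OF A(1)] by (rule Inf_lower) (use S(1) in auto)
  ultimately show ?thesis by (meson enat_ord_simps(1) order_trans)
qed

lemma gen_lspan_irredundant:
  assumes V: "valuation_ring R" and X: "finite X" "irredundant {\<zero>\<^bsub>M\<^esub>} X"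
  shows "gen R (M\<lparr>carrier := lspan X\<rparr>) = enat (card X)"
proof -
  have Xc: "X \<subseteq> carrier M" using X by (simp add: irredundant_def)
  have zero: "submodule {\<zero>\<^bsub>M\<^esub>} R M" using submodule_lspan[of "{}"] lspan_empty by simp
  show ?thesis
    unfolding gen_submodule[OF submodule_lspan[OF Xc]]
  proof (rule antisym)
    show "Inf {enat (card S) | S. finite S \<and> S \<subseteq> lspan X \<and> lspan S = lspan X} \<le> enat (card X)"
      by (rule Inf_lower) (use X lspan_superset in auto)
    show "enat (card X) \<le> Inf {enat (card S) | S. finite S \<and> S \<subseteq> lspan X \<and> lspan S = lspan X}"
    proof (rule Inf_greatest)
      fix m assume "m \<in> {enat (card S) | S. finite S \<and> S \<subseteq> lspan X \<and> lspan S = lspan X}"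
      then obtain S where S: "m = enat (card S)" "finite S" "S \<subseteq> lspan X" "lspan S = lspan X" by auto
      have "X \<subseteq> lspan (S \<union> {\<zero>\<^bsub>M\<^esub>})"
        using S(4) lspan_superset[of X] lspan_mono[of S "S \<union> {\<zero>\<^bsub>M\<^esub>}"] by auto
      moreover have "S \<subseteq> carrier M" using S(3) lspan_subset_carrier[OF Xc] by auto
      ultimately show "enat (card X) \<le> m"
        using card_irredundant_le_generators[OF V zero S(2) _ X] S(1) by simp
    qed
  qed
qed

text \<open>The set is built from the top of the chain downwards, since a suitable element of \<open>D i\<close> can
only be chosen when the elements belonging to the higher members of the chain are known.\<close>
lemma irredundant_of_pure_chain:
  assumes V: "valuation_ring R"
    and D: "\<And>i. i \<le> k \<Longrightarrow> submodule (D i) R M \<and> relatively_divisible (D i)"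
    and strict: "\<And>i. i < k \<Longrightarrow> D i \<subset> D (Suc i)"
  shows "\<exists>X. finite X \<and> card X = k \<and> irredundant (D 0) X"
proof -
  have "\<exists>X. finite X \<and> card X = j \<and> irredundant (D (k - j)) X" if "j \<le> k" for j
    using that
  proof (induction j)
    case 0
    show ?case by (intro exI[of _ "{}"]) (simp add: irredundant_def)
  next
    case (Suc j)
    then obtain X where X: "finite X" "card X = j" "irredundant (D (k - j)) X" by auto
    have eq: "Suc (k - Suc j) = k - j" using Suc.prems by simp
    have "D (k - Suc j) \<subset> D (k - j)" using strict[of "k - Suc j"] eq Suc.prems by simp
    then obtain x where "x \<notin> X" "irredundant (D (k - Suc j)) (insert x X)"
      using irredundant_extend[OF V _ _ _ _ X(1,3)] D[of "k - j"] D[of "k - Suc j"] by auto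
    then show ?case using X by (intro exI[of _ "insert x X"]) auto
  qed
  from this[of k] show ?thesis by simp
qed

end

theorem proposition3p2:
  fixes R :: "('r, 'p) ring_scheme"
    and M :: "('r, 'a, 'm) module_scheme"
    and n :: nat
    and Ms :: "nat \<Rightarrow> 'a set"
  assumes "valuation_ring R"
    and "polyserial R M"
    and "pure_composition_series R M n Ms"
    and "uniserial_factors R M n Ms"
  shows "enat n = Malcev_rank R M"
proof -
  interpret module R M using assms(2) by (simp add: polyserial_def)
  have zero: "Ms 0 = {\<zero>\<^bsub>M\<^esub>}" and top: "Ms n = carrier M"
    and strict: "\<And>k. k < n \<Longrightarrow> Ms k \<subset> Ms (Suc k)"
    and pure: "\<And>k. k \<le> n \<Longrightarrow> pure_submodule R M (Ms k)"
    using assms(3) by (auto simp: pure_composition_series_def)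
  have sub: "submodule (Ms k) R M" if "k \<le> n" for k
    using pure[OF that] by (simp add: pure_submodule_def)
  show ?thesis
    unfolding Malcev_rank_def
  proof (rule antisym)
    obtain X where X: "finite X" "card X = n" "irredundant {\<zero>\<^bsub>M\<^esub>} X"
      using irredundant_of_pure_chain[OF assms(1), of n Ms] strict sub pure
        pure_submodule_relatively_divisible zero by auto
    have Xc: "X \<subseteq> carrier M" using X(3) by (simp add: irredundant_def)
    have "gen R (M\<lparr>carrier := lspan X\<rparr>) = enat n"
      using gen_lspan_irredundant[OF assms(1) X(1,3)] X(2) by simp
    then show "enat n \<le> Sup {gen R (M\<lparr>carrier := A\<rparr>) | A. submodule A R M \<and> gen R (M\<lparr>carrier := A\<rparr>) < \<infinity>}"
      using submodule_lspan[OF Xc] by (intro Sup_upper) force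
    show "Sup {gen R (M\<lparr>carrier := A\<rparr>) | A. submodule A R M \<and> gen R (M\<lparr>carrier := A\<rparr>) < \<infinity>} \<le> enat n"
    proof (rule Sup_least)
      fix g assume "g \<in> {gen R (M\<lparr>carrier := A\<rparr>) | A. submodule A R M \<and> gen R (M\<lparr>carrier := A\<rparr>) < \<infinity>}"
      then obtain A where A: "submodule A R M" "gen R (M\<lparr>carrier := A\<rparr>) < \<infinity>" "g = gen R (M\<lparr>carrier := A\<rparr>)"
        by blast
      have "x \<in> lspan (insert y (Ms i)) \<or> y \<in> lspan (insert x (Ms i))"
        if "i < n" "x \<in> Ms (Suc i)" "y \<in> Ms (Suc i)" for i x y
        using that sub[of i] sub[of "Suc i"] strict[of i] assms(4)
        by (intro uniserial_factor_comparable[of "Ms (Suc i)"]) (auto simp: uniserial_factors_def)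
      then show "g \<le> enat n"
        unfolding A(3) by (intro gen_le_chain_length[of n Ms] sub zero top A(1,2))
    qed
  qed
qed

end
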